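(* The Gabidulin index $\mathrm{ind}(\mathcal C)$ and the value $h(\mathcal C)$ of the following $\mathbb F_{q^n}$-linear MRD codes $\mathcal C\subseteq\mathcal L_{n,q}$ of dimension $k$ are: (a) $\mathcal G_{k,s}=\langle x,x^{[s]},\ldots,x^{[s(k-1)]}\rangle_{\mathbb F_{q^n}}$ ($\gcd(s,n)=1$, $1\le k<n$): $\mathrm{ind}=k$, $h=k-1$; (b) $\mathcal H_{k,s}(\eta)=\langle x+\eta x^{[sk]},x^{[s]},\ldots,x^{[s(k-1)]}\rangle_{\mathbb F_{q^n}}$ ($\gcd(s,n)=1$, $1<k<n-1$, $\eta\ne0$, $\mathrm N_{q^n/q}(\eta)\ne(-1)^{nk}$): $\mathrm{ind}=k-1$, $h=k-2$; (c) $n=6$, $\mathcal C_1=\langle x,\delta x^{[1]}+x^{[4]}\rangle_{\mathbb F_{q^6}}$ ($q>4$, $\delta\in\mathbb F_{q^6}$ such that $\mathcal C_1$ is MRD): $\mathrm{ind}=1$, $h=0$; (d) $n=6$, $\mathcal C_2=\langle x,x^{[1]}+x^{[3]}+\delta x^{[5]}\rangle_{\mathbb F_{q^6}}$ ($q$ odd, $q\equiv0,\pm1\pmod 5$, $\delta\in\mathbb F_q$, $\delta^2+\delta=1$): $\mathrm{ind}=1$, $h=0$; (e) $n=7$, $\mathcal C_3=\langle x,x^{[s]},x^{[3s]}\rangle_{\mathbb F_{q^7}}$ ($q$ odd, $\gcd(s,7)=1$): $\mathrm{ind}=2$, $h=1$; (f) $n=8$, $\mathcal C_4=\langle x,\delta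 x^{[1]}+x^{[5]}\rangle_{\mathbb F_{q^8}}$ ($q$ odd, $\delta^2=-1$): $\mathrm{ind}=1$, $h=0$; (g) $n=8$, $\mathcal C_5=\langle x,x^{[s]},x^{[3s]}\rangle_{\mathbb F_{q^8}}$ ($q\equiv1\pmod3$, $\gcd(s,8)=1$): $\mathrm{ind}=2$, $h=1$; (h) $n=6$, $\mathcal D_1=\langle x^{[1]},x^{[2]},x^{[4]},x-\delta^{[5]}x^{[3]}\rangle_{\mathbb F_{q^6}}$ (with $q,\delta$ as in (c)): $\mathrm{ind}=2$, $h=2$; (i) $n=6$, $\mathcal D_2=\langle x^{[1]},x^{[3]},x-x^{[2]},x^{[4]}-\delta x\rangle_{\mathbb F_{q^6}}$ (with $q,\delta$ as in (d)): $\mathrm{ind}=2$, $h=2$; (j) $n=7$, $\mathcal D_3=\langle x,x^{[2s]},x^{[3s]},x^{[4s]}\rangle_{\mathbb F_{q^7}}$ ($q$ odd, $\gcd(s,7)=1$): $\mathrm{ind}=3$, $h=2$; (k) $n=8$, $\mathcal D_4=\langle x^{[1]},x^{[2]},x^{[3]},x^{[5]},x^{[6]},x-\delta x^{[4]}\rangle_{\mathbb F_{q^8}}$ ($q$ odd, $\delta^2=-1$): $\mathrm{ind}=3$, $h=4$; (l) $n=8$, $\mathcal D_5=\langle x,x^{[2s]},x^{[3s]},x^{[4s]},x^{[5s]}\rangle_{\mathbb F_{q^8}}$ ($q\equiv1\pmod3$, $\gcd(s,8)=1$): $\mathrm{ind}=4$, $h=3$.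
   Context: $q$ is a prime power, $[i]:=q^i$. $\mathcal L_{n,q}$ is the $\mathbb F_{q^n}$-vector space of linearized polynomials $f(x)=\sum_{i=0}^{n-1}a_ix^{[i]}$, $a_i\in\mathbb F_{q^n}$, identified with $\mathbb F_q$-linear maps of $\mathbb F_{q^n}$; rank distance is $\mathrm{rk}(f-g)$ and a code with minimum distance $d$ is MRD if $|\mathcal C|=q^{n(n-d+1)}$. For $f(x)=\sum_i a_ix^{[i]}$, $f(x)^{[j]}:=x^{[j]}\circ f(x)=\sum_i a_i^{[j]}x^{[(i+j)\bmod n]}$, and $\mathcal C^{[j]}=\{f^{[j]}\colon f\in\mathcal C\}$. $h(\mathcal C):=\max\{\dim_{\mathbb F_{q^n}}(\mathcal C\cap\mathcal C^{[j]})\colon 1\le j\le n-1,\ \gcd(j,n)=1\}$. A generalized Gabidulin code is any code equivalent to some $\mathcal G_{l,s}=\langle x,x^{[s]},\ldots,x^{[s(l-1)]}\rangle_{\mathbb F_{q^n}}$ with $\gcd(s,n)=1$, where codes $\mathcal C,\mathcal C'$ are equivalent if there are invertible $h,g\in\mathcal L_{n,q}$ and a field automorphism $\sigma$ (acting on coefficients) with $\{h\circ f^\sigma\circ g\colon f\in\mathcal C\}=\mathcal C'$. The Gabidulin index $\mathrm{ind}(\mathcal C)$ is the maximum dimension of an $\mathbb F_{q^n}$-subspace $\mathcal G\subseteq\mathcal C$ equivalent to a generalized Gabidulin code. $\mathrm N_{q^n/q}(\eta)=\prod_{i=0}^{n-1}\eta^{[i]}$. *)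

theory Defs
  imports Main "HOL-Library.Function_Algebras" "HOL-Number_Theory.Prime_Powers"
begin

text \<open>The field F_{q^n} is a finite field type 'a with CARD('a) = q^n.
 Elements of L_{n,q} are represented by the F_q-linear maps 'a => 'a they define
 (q-polynomials of q-degree < n correspond bijectively to such maps).\<close>

definition Fq :: "nat \<Rightarrow> 'a::field set" where
  "Fq q = {c. c ^ q = c}"

definition fq_linear :: "nat \<Rightarrow> ('a::field \<Rightarrow> 'a) \<Rightarrow> bool" where
  "fq_linear q f \<longleftrightarrow> (\<forall>x y. f (x + y) = f x + f y) \<and> (\<forall>c\<in>Fq q. \<forall>x. f (c * x) = c * f x)"

definition frob :: "nat \<Rightarrow> nat \<Rightarrow> 'a::field \<Rightarrow> 'a" where
  "frob q i = (\<lambda>x. x ^ (q ^ i))"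

definition lscale :: "'a::field \<Rightarrow> ('a \<Rightarrow> 'a) \<Rightarrow> ('a \<Rightarrow> 'a)" where
  "lscale c f = (\<lambda>x. c * f x)"

abbreviation lspan :: "('a::field \<Rightarrow> 'a) set \<Rightarrow> ('a \<Rightarrow> 'a) set" where
  "lspan S \<equiv> module.span lscale S"

abbreviation ldim :: "('a::field \<Rightarrow> 'a) set \<Rightarrow> nat" where
  "ldim S \<equiv> vector_space.dim lscale S"

abbreviation lsubspace :: "('a::field \<Rightarrow> 'a) set \<Rightarrow> bool" where
  "lsubspace S \<equiv> module.subspace lscale S"

definition qshift :: "nat \<Rightarrow> nat \<Rightarrow> ('a::field \<Rightarrow> 'a) \<Rightarrow> ('a \<Rightarrow> 'a)" where
  "qshift q j f = frob q j \<circ> f"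

definition code_shift :: "nat \<Rightarrow> nat \<Rightarrow> ('a::field \<Rightarrow> 'a) set \<Rightarrow> ('a \<Rightarrow> 'a) set" where
  "code_shift q j C = qshift q j ` C"

definition h_val :: "nat \<Rightarrow> nat \<Rightarrow> ('a::field \<Rightarrow> 'a) set \<Rightarrow> nat" where
  "h_val q n C = Max {ldim (C \<inter> code_shift q j C) | j. 1 \<le> j \<and> j \<le> n - 1 \<and> coprime j n}"

definition field_aut :: "('a::field \<Rightarrow> 'a) \<Rightarrow> bool" where
  "field_aut \<sigma> \<longleftrightarrow> bij \<sigma> \<and> (\<forall>x y. \<sigma> (x + y) = \<sigma> x + \<sigma> y) \<and> (\<forall>x y. \<sigma> (x * y) = \<sigma> x * \<sigma> y)"

text \<open>f^sigma (sigma acting on the coefficients) as a map is sigma o f o sigma^{-1}\<close>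
definition aut_act :: "('a \<Rightarrow> 'a) \<Rightarrow> ('a \<Rightarrow> 'a) \<Rightarrow> ('a \<Rightarrow> 'a)" where
  "aut_act \<sigma> f = \<sigma> \<circ> f \<circ> inv \<sigma>"

definition code_equiv :: "nat \<Rightarrow> ('a::field \<Rightarrow> 'a) set \<Rightarrow> ('a \<Rightarrow> 'a) set \<Rightarrow> bool" where
  "code_equiv q C C' \<longleftrightarrow> (\<exists>h g \<sigma>. fq_linear q h \<and> bij h \<and> fq_linear q g \<and> bij g \<and> field_aut \<sigma> \<and>
      (\<lambda>f. h \<circ> aut_act \<sigma> f \<circ> g) ` C = C')"

definition gab :: "nat \<Rightarrow> nat \<Rightarrow> nat \<Rightarrow> ('a::field \<Rightarrow> 'a) set" where
  "gab q l s = lspan {frob q (s * i) | i. i < l}"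

definition gen_gab :: "nat \<Rightarrow> nat \<Rightarrow> ('a::field \<Rightarrow> 'a) set \<Rightarrow> bool" where
  "gen_gab q n C \<longleftrightarrow> (\<exists>l s. coprime s n \<and> code_equiv q C (gab q l s))"

definition gab_index :: "nat \<Rightarrow> nat \<Rightarrow> ('a::field \<Rightarrow> 'a) set \<Rightarrow> nat" where
  "gab_index q n C = Max {ldim G | G. G \<subseteq> C \<and> lsubspace G \<and> gen_gab q n G}"

text \<open>rank over F_q: dim_{F_q} of the image, i.e. the r with |im f| = q^r\<close>
definition rk :: "nat \<Rightarrow> ('a::field \<Rightarrow> 'a) \<Rightarrow> nat" where
  "rk q f = (THE r. card (range f) = q ^ r)"

definition min_dist :: "nat \<Rightarrow> ('a::field \<Rightarrow> 'a) set \<Rightarrow> nat" where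
  "min_dist q C = Min {rk q f | f. f \<in> C \<and> f \<noteq> 0}"

definition MRD :: "nat \<Rightarrow> nat \<Rightarrow> ('a::field \<Rightarrow> 'a) set \<Rightarrow> bool" where
  "MRD q n C \<longleftrightarrow> card C = q ^ (n * (n - min_dist q C + 1))"

definition normq :: "nat \<Rightarrow> nat \<Rightarrow> 'a::field \<Rightarrow> 'a" where
  "normq q n \<eta> = (\<Prod>i<n. \<eta> ^ (q ^ i))"

end

theory Submission
  imports Defs "HOL-Computational_Algebra.Polynomial" "HOL-Library.Cardinality" "HOL-Number_Theory.Cong"
begin

text \<open>
  Since \<open>s\<close> is coprime to \<open>n\<close>, the map \<open>x \<mapsto> x\<^bsup>[s]\<^esup>\<close> generates the Galois group, and every \<open>q\<close>-polynomial
  has unique coefficients with respect to its powers \<open>T 0, \<dots>, T (n - 1)\<close>; composing with \<open>T j\<close> shifts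
  the coefficients cyclically. A Gabidulin subspace of dimension \<open>d\<close> is spanned by an orbit
  \<open>g, T j \<circ> g, \<dots>, T (j (d - 1)) \<circ> g\<close> of an invertible \<open>g\<close>, because its left idealizer contains the scalars.
  Hence \<open>ind \<le> h + 1\<close>, and both invariants of a concrete code reduce to comparing the linear relations
  between the coefficients of its elements with their cyclic shifts. For the three dual codes
  with \<open>ind < h + 1\<close> the same relations exclude longer orbits directly.
\<close>

text \<open>Dropping the first map of an orbit of length d in C leaves d - 1 independent maps lying
  both in C and in its shift by j; this is why ind is at most h + 1. For nine of the twelve codes
  the bound is attained, so an upper bound for h and one explicit orbit settle both values. In D_1,
  D_2 and D_4 the largest intersection is assembled from several short chains instead of one long
  orbit, hence the separate argument there. The obstacle is equivalence: the outer map h is only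
  linear over the small field and need not respect multiplication by elements of the large field.
  That the left idealizer of a Gabidulin code consists of scalars only is what restores this.
  Dimensions are compared by counting elements, so a bound needs just an injection into or from
  coordinate tuples. The parameter conditions enter as nonvanishing facts: \<delta> \<noteq> 0 for
  D_1 from the MRD property, \<delta> \<noteq> 1 and \<delta>^3 \<noteq> 1 for D_2 from \<delta>^2 +
  \<delta> = 1 with q odd.\<close>

lemma finite_field_power_CARD:
  fixes x :: "'a :: {field, finite}"
  shows "x ^ CARD('a) = x"
proof (cases "x = 0")
  case False
  have "(\<Prod>y\<in>UNIV-{0}. x * y) = \<Prod>(UNIV-{0})"
    by (rule prod.reindex_bij_witness[of _ "\<lambda>y. y / x" "\<lambda>y. x * y"]) (use False in auto)
  moreover have "\<Prod>(UNIV-{0::'a}) \<noteq> 0"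
    by simp
  ultimately have "x ^ (CARD('a) - 1) = 1"
    by (simp add: prod.distrib)
  moreover have "CARD('a) = Suc (CARD('a) - 1)"
    by simp
  ultimately show ?thesis
    by (metis mult.right_neutral power_Suc)
qed (simp add: card_gt_0_iff)

subsection \<open>Left-linear spaces of maps\<close>

global_interpretation ls: vector_space "lscale :: 'a::field \<Rightarrow> ('a \<Rightarrow> 'a) \<Rightarrow> 'a \<Rightarrow> 'a"
  by unfold_locales (auto simp: lscale_def algebra_simps fun_eq_iff)

lemma lscale_apply [simp]: "lscale c f x = c * f x"
  by (simp add: lscale_def)

lemma sum_apply: "(\<Sum>i\<in>I. f i) x = (\<Sum>i\<in>I. f i x)"
  by (induction I rule: infinite_finite_induct) auto

text \<open>Coordinates with respect to a basis identify the space with the tuples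
  \<open>B \<rightarrow>\<^sub>E UNIV\<close>. This turns every later dimension estimate into a
  count.\<close>

lemma card_lsubspace:
  fixes S :: "('a::{field,finite} \<Rightarrow> 'a) set"
  assumes "lsubspace S"
  shows "card S = CARD('a) ^ ldim S"
proof -
  obtain B where B: "B \<subseteq> S" "ls.independent B" "S \<subseteq> ls.span B" "card B = ldim S"
    by (rule ls.basis_exists)
  have fin: "finite B" by simp
  have S: "S = ls.span B"
    using B assms by (simp add: ls.span_minimal subset_antisym)
  define \<phi> where "\<phi> = (\<lambda>u. \<Sum>v\<in>B. lscale (u v :: 'a) v)"
  have "\<phi> ` (B \<rightarrow>\<^sub>E UNIV) = range \<phi>"
  proof (rule equalityI; rule subsetI)
    fix f assume "f \<in> range \<phi>"
    then obtain u where "f = \<phi> u" by blast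
    moreover have "\<phi> u = \<phi> (restrict u B)" by (simp add: \<phi>_def)
    ultimately show "f \<in> \<phi> ` (B \<rightarrow>\<^sub>E UNIV)" by simp
  qed blast
  moreover have "inj_on \<phi> (B \<rightarrow>\<^sub>E UNIV)"
  proof (rule inj_onI)
    fix u w :: "('a \<Rightarrow> 'a) \<Rightarrow> 'a"
    assume uw: "u \<in> B \<rightarrow>\<^sub>E UNIV" "w \<in> B \<rightarrow>\<^sub>E UNIV" "\<phi> u = \<phi> w"
    then have "(\<Sum>v\<in>B. lscale (u v - w v) v) = 0"
      by (simp add: \<phi>_def ls.scale_left_diff_distrib sum_subtractf)
    then have "\<forall>v\<in>B. u v = w v"
      using ls.independentD[OF B(2) fin subset_refl, where u = "\<lambda>v. u v - w v"] by auto
    with uw show "u = w" by (intro PiE_ext[OF uw(1,2)]) simp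
  qed
  moreover have "S = range \<phi>"
    unfolding S \<phi>_def by (rule ls.span_finite[OF fin])
  ultimately have "card S = card (B \<rightarrow>\<^sub>E (UNIV :: 'a set))"
    using card_image[of \<phi> "B \<rightarrow>\<^sub>E UNIV"] by simp
  then show ?thesis
    using B(4) by (simp add: card_PiE fin)
qed

lemma CARD_field_gt_1: "1 < CARD('a::{field,finite})"
proof -
  have "card {0::'a, 1} \<le> CARD('a)"
    by (rule card_mono) auto
  then show ?thesis by simp
qed

lemma ldim_le_iff_card:
  fixes S :: "('a::{field,finite} \<Rightarrow> 'a) set"
  assumes "lsubspace S"
  shows "ldim S \<le> d \<longleftrightarrow> card S \<le> CARD('a) ^ d"
  using power_increasing_iff[OF CARD_field_gt_1[where ?'a = 'a]] by (simp add: card_lsubspace[OF assms])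

lemma ldim_ge_iff_card:
  fixes S :: "('a::{field,finite} \<Rightarrow> 'a) set"
  assumes "lsubspace S"
  shows "d \<le> ldim S \<longleftrightarrow> CARD('a) ^ d \<le> card S"
  using power_increasing_iff[OF CARD_field_gt_1[where ?'a = 'a]] by (simp add: card_lsubspace[OF assms])

lemma ldim_mono:
  fixes S :: "('a::{field,finite} \<Rightarrow> 'a) set"
  assumes "lsubspace S" "lsubspace S'" "S \<subseteq> S'"
  shows "ldim S \<le> ldim S'"
  using assms(3) by (simp add: ldim_le_iff_card[OF assms(1)] card_mono flip: card_lsubspace[OF assms(2)])

lemma ldim_eq_if_card_eq:
  fixes S S' :: "('a::{field,finite} \<Rightarrow> 'a) set"
  assumes "lsubspace S" "lsubspace S'" "card S = card S'"
  shows "ldim S = ldim S'"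
  using assms(3) power_inject_exp[OF CARD_field_gt_1[where ?'a = 'a]]
  unfolding card_lsubspace[OF assms(1)] card_lsubspace[OF assms(2)] by simp

lemma lsubspace_comp_right:
  assumes "lsubspace S"
  shows "lsubspace ((\<lambda>f. f \<circ> g) ` S)"
proof (rule ls.subspaceI)
  have "0 = 0 \<circ> g" by auto
  then show "0 \<in> (\<lambda>f. f \<circ> g) ` S" using ls.subspace_0[OF assms] by blast
next
  fix x y assume "x \<in> (\<lambda>f. f \<circ> g) ` S" "y \<in> (\<lambda>f. f \<circ> g) ` S"
  then obtain u v where "x = u \<circ> g" "y = v \<circ> g" "u \<in> S" "v \<in> S" by blast
  moreover have "(u \<circ> g) + (v \<circ> g) = (u + v) \<circ> g" by auto
  ultimately show "x + y \<in> (\<lambda>f. f \<circ> g) ` S"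
    using ls.subspace_add[OF assms] by simp
next
  fix c x assume "x \<in> (\<lambda>f. f \<circ> g) ` S"
  then obtain u where "x = u \<circ> g" "u \<in> S" by blast
  moreover have "lscale c (u \<circ> g) = lscale c u \<circ> g" by auto
  ultimately show "lscale c x \<in> (\<lambda>f. f \<circ> g) ` S"
    using ls.subspace_scale[OF assms] by simp
qed

lemma ldim_comp_right:
  fixes S :: "('a::{field,finite} \<Rightarrow> 'a) set"
  assumes "lsubspace S" "surj g"
  shows "ldim ((\<lambda>f. f \<circ> g) ` S) = ldim S"
proof -
  have "inj_on (\<lambda>f. f \<circ> g) S"
  proof (rule inj_onI)
    fix u v assume "u \<circ> g = v \<circ> g"
    then have "u (g x) = v (g x)" for x by (simp add: fun_eq_iff)
    then show "u = v" by (intro ext) (metis assms(2) surjD)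
  qed
  then show ?thesis
    using assms by (intro ldim_eq_if_card_eq lsubspace_comp_right) (auto simp: card_image)
qed

subsection \<open>Arithmetic of small exponents\<close>

lemma nat_less_7_cases: "i < 7 \<Longrightarrow> i = 0 \<or> i = 1 \<or> i = 2 \<or> i = 3 \<or> i = 4 \<or> i = 5 \<or> i = (6::nat)"
  by linarith

lemma nat_less_8_cases: "i < 8 \<Longrightarrow> i = 7 \<or> i < (7::nat)"
  by linarith

lemma coprime_6_cases: "j < 6 \<Longrightarrow> coprime j 6 \<Longrightarrow> j = 1 \<or> j = (5::nat)"
  using nat_less_7_cases[of j] coprime_common_divisor[of j 6 2] coprime_common_divisor[of j 6 3]
  by auto

lemma coprime_8_cases: "j < 8 \<Longrightarrow> coprime j 8 \<Longrightarrow> j = 1 \<or> j = 3 \<or> j = 5 \<or> j = (7::nat)"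
  using nat_less_7_cases[of j] nat_less_8_cases[of j] coprime_common_divisor[of j 8 2]
  by auto

text \<open>Lets simp evaluate a filter over an explicit finite set, as needed for counting cyclic
  differences.\<close>

lemma conj_Collect_insert:
  "{i \<in> insert a D. P i} = (if P a then insert a {i \<in> D. P i} else {i \<in> D. P i})"
  by auto

subsection \<open>Frobenius powers\<close>

locale frob_field =
  fixes q n :: nat and F :: "'a::{field,finite} itself"
  assumes primepow_q: "primepow q" and card_F: "CARD('a) = q ^ n"
begin

lemma n_pos: "0 < n"
  using card_F CARD_field_gt_1[where ?'a = 'a] by (cases n) auto

lemma q_gt_1: "1 < q"
  using primepow_q by (rule primepow_gt_Suc_0[unfolded One_nat_def[symmetric]])

lemma frob_apply: "frob q i x = x ^ (q ^ i)"
  by (simp add: frob_def)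

lemma frob_0_left [simp]: "frob q 0 = id"
  by (simp add: frob_def fun_eq_iff)

lemma frob_zero [simp]: "frob q i (0::'a) = 0"
  using q_gt_1 by (simp add: frob_apply)

lemma frob_one [simp]: "frob q i (1::'a) = 1"
  by (simp add: frob_apply)

lemma frob_eq_0_iff [simp]: "frob q i (x::'a) = 0 \<longleftrightarrow> x = 0"
  using q_gt_1 by (simp add: frob_apply)

text \<open>Adding 1 permutes the field, so the sum of all elements does not change when each of
  them grows by 1.\<close>

lemma of_nat_card: "(of_nat (q ^ n) :: 'a) = 0"
proof -
  have "(\<Sum>x\<in>UNIV. x + 1) = (\<Sum>x\<in>UNIV. x :: 'a)"
    by (rule sum.reindex_bij_witness[of _ "\<lambda>x. x - 1" "\<lambda>x. x + 1"]) auto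
  then show ?thesis
    by (simp add: sum.distrib flip: card_F)
qed

lemma two_neq_zero_if_odd:
  assumes "odd q"
  shows "(2 :: 'a) \<noteq> 0"
proof
  assume "(2 :: 'a) = 0"
  moreover obtain m where "q ^ n = 2 * m + 1"
    using assms by (metis even_power oddE)
  then have "(of_nat (2 * m + 1) :: 'a) = 0"
    using of_nat_card by simp
  ultimately show False by simp
qed

lemma frob_add: "frob q i (x + y) = frob q i x + frob q i (y::'a)"
proof -
  obtain p m where p: "prime p" "q = p ^ m"
    using primepow_q by (auto simp: primepow_def)
  have "(of_nat p :: 'a) = 0"
    using of_nat_card by (auto simp: p(2))
  then have "CHAR('a) dvd p"
    by (simp add: of_nat_eq_0_iff_char_dvd)
  then have "CHAR('a) = p"
    using p(1) CHAR_not_1[where ?'a = 'a] by (metis One_nat_def prime_nat_iff)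
  then show ?thesis
    using freshmans_dream'[of "q ^ i" "m * i" x y] p by (simp add: frob_def power_mult)
qed

lemma frob_mult: "frob q i (x * y) = frob q i x * frob q i (y::'a)"
  by (simp add: frob_apply power_mult_distrib)

lemma frob_uminus: "frob q i (- x) = - frob q i (x::'a)"
  using frob_add[of i x "-x"] by (simp add: eq_neg_iff_add_eq_0 add.commute)

lemma frob_diff: "frob q i (x - y) = frob q i x - frob q i (y::'a)"
  using frob_add[of i x "-y"] by (simp add: frob_uminus)

lemma frob_sum: "frob q i (\<Sum>j\<in>I. f j) = (\<Sum>j\<in>I. frob q i (f j :: 'a))"
  by (induction I rule: infinite_finite_induct) (auto simp: frob_add)

lemma frob_frob: "frob q i (frob q j x) = frob q (i + j) (x::'a)"
  by (simp add: frob_apply power_add mult.commute flip: power_mult)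

lemma frob_comp: "frob q i \<circ> frob q j = (frob q (i + j) :: 'a \<Rightarrow> 'a)"
  by (simp add: fun_eq_iff frob_frob)

lemma frob_n [simp]: "frob q n = (id :: 'a \<Rightarrow> 'a)"
  by (simp add: fun_eq_iff frob_apply finite_field_power_CARD flip: card_F)

lemma frob_mult_n [simp]: "frob q (n * i) = (id :: 'a \<Rightarrow> 'a)"
proof (induction i)
  case (Suc i)
  then show ?case using frob_comp[of n "n * i"] by simp
qed simp

lemma frob_mod: "frob q (i mod n) = (frob q i :: 'a \<Rightarrow> 'a)"
  using frob_comp[of "n * (i div n)" "i mod n"] unfolding mult_div_mod_eq by simp

lemma frob_cong: "[i = j] (mod n) \<Longrightarrow> frob q i = (frob q j :: 'a \<Rightarrow> 'a)"
  by (metis cong_def frob_mod)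

lemma bij_frob: "bij (frob q i :: 'a \<Rightarrow> 'a)"
proof (rule o_bij)
  have *: "i + (n - 1) * i = n * i"
    using n_pos by (cases n) simp_all
  show "frob q ((n - 1) * i) \<circ> frob q i = (id :: 'a \<Rightarrow> 'a)"
    "frob q i \<circ> frob q ((n - 1) * i) = (id :: 'a \<Rightarrow> 'a)"
    unfolding frob_comp add.commute[of "(n - 1) * i"] * by simp_all
qed

lemma frob_Fq: "c \<in> Fq q \<Longrightarrow> frob q i c = (c::'a)"
  by (induction i) (auto simp: frob_apply Fq_def power_mult)

lemma fq_linear_frob: "fq_linear q (frob q i :: 'a \<Rightarrow> 'a)"
  by (auto simp: fq_linear_def frob_add frob_mult frob_Fq)

text \<open>Read as an ordinary polynomial, the sum has degree \<open>q ^ m\<close>. This is the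
  source of both the uniqueness of coefficients and the later rank computation.\<close>

lemma card_frob_roots_le:
  fixes c :: "nat \<Rightarrow> 'a"
  assumes I: "finite I" "m \<in> I" "\<And>i. i \<in> I \<Longrightarrow> i \<le> m" and c: "c m \<noteq> 0"
  shows "card {x. (\<Sum>i\<in>I. c i * frob q i x) = 0} \<le> q ^ m"
proof -
  define p where "p = (\<Sum>i\<in>I. monom (c i) (q ^ i))"
  have "coeff p (q ^ m) = c m"
    using I(1,2) q_gt_1 by (simp add: p_def coeff_sum if_distrib cong: if_cong)
  then have "p \<noteq> 0" using c by auto
  have "{x. poly p x = 0} = {x. (\<Sum>i\<in>I. c i * frob q i x) = 0}"
    by (simp add: p_def poly_sum poly_monom frob_apply)
  moreover have "degree p \<le> q ^ m"
    unfolding p_def using I q_gt_1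
    by (intro degree_sum_le order_trans[OF degree_monom_le] power_increasing) auto
  ultimately show ?thesis
    using card_poly_roots_bound[OF \<open>p \<noteq> 0\<close>] by simp
qed

text \<open>A nontrivial relation would have all \<open>q ^ n\<close> field elements as roots, too
  many for its largest occurring index \<open>m < n\<close>.\<close>

lemma frob_independent:
  assumes 0: "\<And>x::'a. (\<Sum>i<n. c i * frob q i x) = 0" and "i < n"
  shows "c i = 0"
proof (rule ccontr)
  assume "c i \<noteq> 0"
  define I m where "I = {i \<in> {..<n}. c i \<noteq> 0}" and "m = Max I"
  have I: "finite I" "i \<in> I" using \<open>c i \<noteq> 0\<close> assms(2) by (auto simp: I_def)
  then have m: "m \<in> I" "\<And>i. i \<in> I \<Longrightarrow> i \<le> m" by (auto simp: m_def intro: Max_in)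
  have "(\<Sum>i\<in>I. c i * frob q i x) = (\<Sum>i<n. c i * frob q i x)" for x
    unfolding I_def by (rule sum.mono_neutral_left) auto
  then have "(\<Sum>i\<in>I. c i * frob q i x) = 0" for x
    using 0 by simp
  then have "q ^ n \<le> q ^ m"
    using card_frob_roots_le[OF I(1) m, of c] m(1) by (simp add: I_def flip: card_F)
  then show False
    using m(1) q_gt_1 by (simp add: I_def)
qed

end

subsection \<open>Coefficients of linearized polynomials\<close>

locale galois_gen = frob_field q n F
  for q n :: nat and F :: "'a::{field,finite} itself" +
  fixes s :: nat
  assumes coprime_s: "coprime s n"
begin

definition T :: "nat \<Rightarrow> 'a \<Rightarrow> 'a" where
  "T i = frob q (s * i)"

lemma T_0: "T 0 = id"
  by (simp add: T_def)

lemma T_zero [simp]: "T i 0 = 0" and T_one [simp]: "T i 1 = 1"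
  and T_eq_0_iff [simp]: "T i x = 0 \<longleftrightarrow> x = 0"
  by (simp_all add: T_def)

lemma T_diff: "T i (x - y) = T i x - T i y"
  and T_uminus: "T i (- x) = - T i x" and T_mult: "T i (x * y) = T i x * T i y"
  and T_sum: "T i (\<Sum>k\<in>K. f k) = (\<Sum>k\<in>K. T i (f k))"
  by (simp_all add: T_def frob_diff frob_uminus frob_mult frob_sum)

lemma T_add: "T (i + j) x = T i (T j x)"
  by (simp add: T_def frob_frob distrib_left)

lemma T_comp: "T i \<circ> T j = T (i + j)"
  by (simp add: fun_eq_iff T_add)

lemma T_cong: "[i = j] (mod n) \<Longrightarrow> T i = T j"
  unfolding T_def by (rule frob_cong) (rule cong_scalar_left)

lemma T_mod: "T (i mod n) = T i"
  by (rule T_cong) simp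

text \<open>Here \<open>r\<close> inverts \<open>s\<close> modulo \<open>n\<close>, so
  multiplication by \<open>r\<close> and by \<open>s\<close> are mutually inverse permutations of
  the residues. They translate between powers of \<open>T 1\<close> and plain Frobenius
  powers.\<close>

lemma inverse_exponent:
  obtains r where "\<And>i. (r * (s * i mod n)) mod n = i mod n" "\<And>i. (s * (r * i mod n)) mod n = i mod n"
    "coprime r n"
proof -
  obtain r where r: "[s * r = 1] (mod n)"
    using cong_solve_coprime_nat[OF coprime_s] by auto
  have rs: "[s * r * i = i] (mod n)" for i
    using cong_scalar_right[OF r, of i] by simp
  show ?thesis
  proof
    show "(r * (s * i mod n)) mod n = i mod n" for i
      using rs[of i] by (simp add: cong_def mod_simps ac_simps)
    show "(s * (r * i mod n)) mod n = i mod n" for i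
      using rs[of i] by (simp add: cong_def mod_simps ac_simps)
    show "coprime r n"
      using r by (metis cong_imp_coprime cong_sym coprime_1_left coprime_mult_left_iff)
  qed
qed

lemma T_independent:
  assumes "\<And>x. (\<Sum>i<n. c i * T i x) = 0" and "i < n"
  shows "c i = 0"
proof -
  obtain r where r: "\<And>i. (r * (s * i mod n)) mod n = i mod n"
      "\<And>i. (s * (r * i mod n)) mod n = i mod n"
    using inverse_exponent by metis
  have "(\<Sum>j<n. c (r * j mod n) * frob q j x) = 0" for x
  proof -
    have "(\<Sum>j<n. c (r * j mod n) * frob q j x) = (\<Sum>i<n. c i * T i x)"
    proof (rule sum.reindex_bij_witness[of _ "\<lambda>i. s * i mod n" "\<lambda>j. r * j mod n"])
      fix j assume "j \<in> {..<n}"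
      then show "s * (r * j mod n) mod n = j" by (simp add: r)
      then have "T (r * j mod n) = frob q j"
        unfolding T_def by (metis frob_mod)
      then show "c (r * j mod n) * T (r * j mod n) x = c (r * j mod n) * frob q j x"
        by simp
    qed (use n_pos r in auto)
    then show ?thesis using assms(1) by simp
  qed
  from frob_independent[OF this, of "s * i mod n"] show ?thesis
    using assms(2) n_pos by (simp add: r)
qed

definition qpoly :: "(nat \<Rightarrow> 'a) \<Rightarrow> 'a \<Rightarrow> 'a" where
  "qpoly c = (\<lambda>x. \<Sum>i<n. c i * T i x)"

definition qpolys :: "('a \<Rightarrow> 'a) set" where
  "qpolys = range qpoly"

text \<open>Indices of coefficients are read modulo \<open>n\<close>.\<close>

definition coef :: "('a \<Rightarrow> 'a) \<Rightarrow> nat \<Rightarrow> 'a" where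
  "coef f i = (SOME c. f = qpoly c) (i mod n)"

lemma qpoly_inject:
  assumes "qpoly c = qpoly d" "i < n"
  shows "c i = d i"
proof -
  have "(\<Sum>i<n. (c i - d i) * T i x) = 0" for x
    using fun_cong[OF assms(1), of x] by (simp add: qpoly_def left_diff_distrib sum_subtractf)
  from T_independent[OF this assms(2)] show ?thesis by simp
qed

lemma qpoly_cong: "(\<And>i. i < n \<Longrightarrow> c i = d i) \<Longrightarrow> qpoly c = qpoly d"
  by (simp add: qpoly_def)

lemma coef_qpoly: "coef (qpoly c) i = c (i mod n)"
proof -
  have "qpoly c = qpoly (SOME d. qpoly c = qpoly d)"
    by (rule someI[of _ c]) simp
  from qpoly_inject[OF this] show ?thesis
    using n_pos by (simp add: coef_def)
qed

lemma qpoly_coef: "f \<in> qpolys \<Longrightarrow> qpoly (coef f) = f"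
  by (auto simp: qpolys_def coef_qpoly intro: qpoly_cong)

lemma coef_mod: "coef f (i mod n) = coef f i"
  by (simp add: coef_def)

lemma coef_cong: "[i = j] (mod n) \<Longrightarrow> coef f i = coef f j"
  by (metis coef_mod cong_def)

lemma qpolys_eqI:
  assumes "f \<in> qpolys" "g \<in> qpolys" "\<And>i. i < n \<Longrightarrow> coef f i = coef g i"
  shows "f = g"
  using qpoly_cong[of "coef f" "coef g"] assms by (simp add: qpoly_coef)

lemma qpoly_0: "qpoly (\<lambda>_. 0) = 0"
  by (simp add: qpoly_def fun_eq_iff)

lemma qpoly_add: "qpoly c + qpoly d = qpoly (\<lambda>i. c i + d i)"
  by (simp add: qpoly_def fun_eq_iff sum.distrib distrib_right)

lemma qpoly_scale: "lscale a (qpoly c) = qpoly (\<lambda>i. a * c i)"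
  by (simp add: qpoly_def fun_eq_iff sum_distrib_left mult.assoc)

lemma subspace_qpolys: "lsubspace qpolys"
proof (rule ls.subspaceI)
  show "0 \<in> qpolys" unfolding qpolys_def using qpoly_0 by (metis rangeI)
qed (auto simp: qpolys_def qpoly_add qpoly_scale)

lemmas qpolys_closed [simp, intro] =
  ls.subspace_0[OF subspace_qpolys] ls.subspace_add[OF subspace_qpolys]
  ls.subspace_scale[OF subspace_qpolys] ls.subspace_diff[OF subspace_qpolys]

lemma coef_0 [simp]: "coef 0 i = 0"
  using coef_qpoly[of "\<lambda>_. 0" i] by (simp add: qpoly_0)

lemma coef_add: "f \<in> qpolys \<Longrightarrow> g \<in> qpolys \<Longrightarrow> coef (f + g) i = coef f i + coef g i"
  by (auto simp: qpolys_def qpoly_add coef_qpoly)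

lemma coef_scale: "f \<in> qpolys \<Longrightarrow> coef (lscale a f) i = a * coef f i"
  by (auto simp: qpolys_def qpoly_scale coef_qpoly)

lemma coef_diff: "f \<in> qpolys \<Longrightarrow> g \<in> qpolys \<Longrightarrow> coef (f - g) i = coef f i - coef g i"
  using coef_add[of "f - g" g i] by simp

lemma coef_sum:
  "(\<And>k. k \<in> K \<Longrightarrow> f k \<in> qpolys) \<Longrightarrow> coef (\<Sum>k\<in>K. f k) i = (\<Sum>k\<in>K. coef (f k) i)"
  by (induction K rule: infinite_finite_induct)
    (auto simp: coef_add ls.subspace_sum[OF subspace_qpolys])

lemma T_eq_qpoly: "T j = qpoly (\<lambda>i. if i = j mod n then 1 else 0)"
proof (rule ext)
  fix x
  have "qpoly (\<lambda>i. if i = j mod n then 1 else 0) x = (\<Sum>i<n. if i = j mod n then T i x else 0)"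
    unfolding qpoly_def by (rule sum.cong) auto
  then show "T j x = qpoly (\<lambda>i. if i = j mod n then 1 else 0) x"
    using n_pos by (simp add: T_mod)
qed

lemma T_in_qpolys [simp]: "T j \<in> qpolys"
  unfolding T_eq_qpoly qpolys_def by simp

lemma coef_T: "coef (T j) i = (if i mod n = j mod n then 1 else 0)"
  unfolding T_eq_qpoly coef_qpoly by simp

text \<open>The residue of \<open>i - j\<close> is written \<open>i + (n - j mod n)\<close>, which
  keeps truncated subtraction harmless. Left composition also twists each coefficient by
  \<open>T j\<close>, in contrast to right composition.\<close>

lemma T_comp_qpoly: "T j \<circ> qpoly c = qpoly (\<lambda>i. T j (c ((i + (n - j mod n)) mod n)))"
proof (rule ext)
  fix x
  have "(T j \<circ> qpoly c) x = (\<Sum>i<n. T j (c i) * T (j + i) x)"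
    by (simp add: qpoly_def T_sum T_mult T_add)
  also have "\<dots> = (\<Sum>i<n. T j (c ((i + (n - j mod n)) mod n)) * T i x)"
  proof (rule sum.reindex_bij_witness[of _ "\<lambda>i. (i + (n - j mod n)) mod n" "\<lambda>i. (i + j) mod n"])
    fix i assume i: "i \<in> {..<n}"
    have *: "(i + (j mod n + (n - j mod n))) mod n = i"
      using i n_pos by (simp add: less_imp_le)
    show 1: "((i + j) mod n + (n - j mod n)) mod n = i"
      using * by (metis (no_types, lifting) add.assoc mod_add_left_eq mod_add_right_eq)
    show "((i + (n - j mod n)) mod n + j) mod n = i"
      using * by (metis (no_types, lifting) add.assoc add.commute mod_add_left_eq mod_add_right_eq)
    show "T j (c (((i + j) mod n + (n - j mod n)) mod n)) * T ((i + j) mod n) x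
      = T j (c i) * T (j + i) x"
      unfolding 1 T_mod by (simp add: add.commute)
  qed (use n_pos in auto)
  finally show "(T j \<circ> qpoly c) x = qpoly (\<lambda>i. T j (c ((i + (n - j mod n)) mod n))) x"
    by (simp add: qpoly_def)
qed

lemma T_comp_in_qpolys: "f \<in> qpolys \<Longrightarrow> T j \<circ> f \<in> qpolys"
  by (auto simp: qpolys_def T_comp_qpoly)

lemma coef_T_comp:
  assumes "f \<in> qpolys"
  shows "coef (T j \<circ> f) (i + j) = T j (coef f i)"
proof -
  obtain c where f: "f = qpoly c" using assms by (auto simp: qpolys_def)
  have "(i + (j mod n + (n - j mod n))) mod n = i mod n"
    using n_pos by (simp add: less_imp_le)
  then have "((i + j) mod n + (n - j mod n)) mod n = i mod n"
    by (metis (no_types, lifting) add.assoc mod_add_left_eq mod_add_right_eq)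
  then show ?thesis by (simp add: f T_comp_qpoly coef_qpoly)
qed

text \<open>The coordinates indexed by \<open>I\<close> embed \<open>S\<close> into the tuples over
  \<open>I\<close>; only a trivial kernel has to be checked.\<close>

lemma ldim_le:
  assumes S: "lsubspace S" "S \<subseteq> qpolys" and I: "finite I"
    and *: "\<And>f. f \<in> S \<Longrightarrow> (\<And>i. i \<in> I \<Longrightarrow> coef f i = 0) \<Longrightarrow> f = 0"
  shows "ldim S \<le> card I"
proof -
  have "inj_on (\<lambda>f. restrict (coef f) I) S"
  proof (rule inj_onI)
    fix f g assume fg: "f \<in> S" "g \<in> S" "restrict (coef f) I = restrict (coef g) I"
    have "coef (f - g) i = 0" if "i \<in> I" for i
      using fg S(2) that by (subst coef_diff) (auto dest: fun_cong[of _ _ i])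
    then show "f = g"
      using *[OF ls.subspace_diff[OF S(1) fg(1,2)]] by simp
  qed
  moreover have "(\<lambda>f. restrict (coef f) I) ` S \<subseteq> I \<rightarrow>\<^sub>E UNIV"
    by auto
  ultimately have "card S \<le> card (I \<rightarrow>\<^sub>E (UNIV :: 'a set))"
    using I by (intro card_inj_on_le finite_PiE) auto
  then show ?thesis
    by (simp add: ldim_le_iff_card[OF S(1)] card_PiE I)
qed

text \<open>The maps \<open>b i\<close> are dual to the coordinates in \<open>I\<close>, so their
  combinations with different tuples of scalars differ.\<close>

lemma ldim_ge:
  assumes S: "lsubspace S" and I: "finite I"
    and b: "\<And>i. i \<in> I \<Longrightarrow> b i \<in> S" "\<And>i. i \<in> I \<Longrightarrow> b i \<in> qpolys"
    and *: "\<And>i j. i \<in> I \<Longrightarrow> j \<in> I \<Longrightarrow> coef (b i) j = (if i = j then 1 else 0)"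
  shows "card I \<le> ldim S"
proof -
  define \<phi> where "\<phi> u = (\<Sum>i\<in>I. lscale (u i) (b i))" for u
  have coef_\<phi>: "coef (\<phi> u) j = u j" if "j \<in> I" for u j
  proof -
    have "coef (\<phi> u) j = (\<Sum>i\<in>I. u i * coef (b i) j)"
      unfolding \<phi>_def using b(2)
      by (subst coef_sum) (auto simp: coef_scale ls.subspace_scale[OF subspace_qpolys])
    also have "\<dots> = (\<Sum>i\<in>I. if i = j then u i else 0)"
      by (rule sum.cong) (use * that in auto)
    finally show ?thesis using that I by simp
  qed
  have "inj_on \<phi> (I \<rightarrow>\<^sub>E UNIV)"
    by (rule inj_onI) (metis PiE_ext coef_\<phi>)
  moreover have "\<phi> ` (I \<rightarrow>\<^sub>E UNIV) \<subseteq> S"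
    using b(1) by (auto simp: \<phi>_def intro!: ls.subspace_sum[OF S] ls.subspace_scale[OF S])
  ultimately have "card (I \<rightarrow>\<^sub>E (UNIV :: 'a set)) \<le> card S"
    by (rule card_inj_on_le) simp
  then show ?thesis
    by (simp add: ldim_ge_iff_card[OF S] card_PiE I)
qed

lemma in_span_if_coef:
  assumes "f \<in> qpolys" "\<And>i. i < n \<Longrightarrow> coef f i \<noteq> 0 \<Longrightarrow> T i \<in> S"
  shows "f \<in> lspan S"
proof -
  have "f = (\<Sum>i<n. lscale (coef f i) (T i))"
    by (subst qpoly_coef[OF assms(1), symmetric]) (simp add: qpoly_def fun_eq_iff sum_apply)
  also have "\<dots> \<in> lspan S"
    by (intro ls.span_sum) (metis assms(2) lessThan_iff ls.scale_zero_left ls.span_base ls.span_scale ls.span_zero)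
  finally show ?thesis .
qed

text \<open>Transfers linear equations between coefficients from the generators to the whole code.
  All concrete codes are accessed only through such equations.\<close>

lemma span_coef_relation:
  assumes f: "f \<in> lspan S" and S: "S \<subseteq> qpolys" "\<And>g. g \<in> S \<Longrightarrow> R (coef g)"
    and R: "R (\<lambda>_. 0)" "\<And>a c d. R c \<Longrightarrow> R d \<Longrightarrow> R (\<lambda>i. a * c i + d i)"
  shows "R (coef f)"
proof -
  have coef: "coef (lscale a g + h) = (\<lambda>i. a * coef g i + coef h i)"
    if "g \<in> qpolys" "h \<in> qpolys" for g h a
    using that by (auto simp: coef_add coef_scale)
  have 0: "coef 0 = (\<lambda>_. 0)" by auto
  \<comment> \<open>Membership in \<open>qpolys\<close> is carried through the induction because
    \<open>coef\<close> is additive only there.\<close>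
  have "f \<in> qpolys \<and> R (coef f)"
    using f
  proof (induction rule: ls.span_induct_alt)
    case base
    show ?case unfolding 0 by (intro conjI qpolys_closed R(1))
  next
    case (step c x y)
    then have "x \<in> qpolys" "R (coef x)" using S by auto
    then show ?case
      using step.IH R(2) unfolding coef[OF \<open>x \<in> qpolys\<close> step.IH[THEN conjunct1]]
      by (intro conjI qpolys_closed) auto
  qed
  then show ?thesis by simp
qed

lemma span_monomials_qpolys: "lspan (T ` D) \<subseteq> qpolys"
  by (rule ls.span_minimal[OF _ subspace_qpolys]) auto

lemma in_span_monomials_iff:
  assumes "D \<subseteq> {..<n}"
  shows "f \<in> lspan (T ` D) \<longleftrightarrow> f \<in> qpolys \<and> (\<forall>i<n. i \<notin> D \<longrightarrow> coef f i = 0)"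
proof
  assume f: "f \<in> lspan (T ` D)"
  have "coef f i = 0" if "i < n" "i \<notin> D" for i
    by (rule span_coef_relation[OF f, where R = "\<lambda>c. c i = 0"])
      (use assms that in \<open>auto simp: coef_T\<close>)
  then show "f \<in> qpolys \<and> (\<forall>i<n. i \<notin> D \<longrightarrow> coef f i = 0)"
    using f span_monomials_qpolys by auto
qed (auto intro: in_span_if_coef)

lemma ldim_span_monomials:
  assumes "D \<subseteq> {..<n}"
  shows "ldim (lspan (T ` D)) = card D"
proof (rule antisym)
  have fin: "finite D" using assms finite_subset by blast
  show "ldim (lspan (T ` D)) \<le> card D"
    using fin by (intro ldim_le)
      (auto simp: in_span_monomials_iff[OF assms] intro!: qpolys_eqI ls.subspace_0[OF subspace_qpolys])
  show "card D \<le> ldim (lspan (T ` D))"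
    using fin assms by (intro ldim_ge[where b = T]) (auto simp: ls.span_base coef_T subset_iff)
qed

lemma gab_eq: "l \<le> n \<Longrightarrow> gab q l s = lspan (T ` {..<l})"
  by (simp add: gab_def setcompr_eq_image lessThan_def T_def[abs_def])

end

subsection \<open>Gabidulin subspaces and the invariant h\<close>

lemma span_comp_right_subset:
  fixes C :: "('a::field \<Rightarrow> 'a) set"
  assumes C: "lsubspace C" and S: "\<And>f. f \<in> S \<Longrightarrow> f \<circ> g \<in> C" and f: "f \<in> lspan S"
  shows "f \<circ> g \<in> C"
proof -
  have "lsubspace {f. f \<circ> g \<in> C}"
  proof (rule ls.subspaceI)
    have "(0 :: 'a \<Rightarrow> 'a) \<circ> g = 0" by auto
    then show "0 \<in> {f. f \<circ> g \<in> C}" using ls.subspace_0[OF C] by simp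
  next
    fix x y assume "x \<in> {f. f \<circ> g \<in> C}" "y \<in> {f. f \<circ> g \<in> C}"
    moreover have "(x + y) \<circ> g = (x \<circ> g) + (y \<circ> g)" by auto
    ultimately show "x + y \<in> {f. f \<circ> g \<in> C}" using ls.subspace_add[OF C] by simp
  next
    fix c x assume "x \<in> {f. f \<circ> g \<in> C}"
    moreover have "lscale c x \<circ> g = lscale c (x \<circ> g)" by auto
    ultimately show "lscale c x \<in> {f. f \<circ> g \<in> C}" using ls.subspace_scale[OF C] by simp
  qed
  then have "lspan S \<subseteq> {f. f \<circ> g \<in> C}"
    using S by (intro ls.span_minimal) auto
  with f show ?thesis by auto
qed

context frob_field
begin

text \<open>The shift is only semilinear: a scalar \<open>c\<close> outside comes from the scalar
  inside whose Frobenius image is \<open>c\<close>, which exists because Frobenius is onto.\<close>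

lemma subspace_code_shift:
  assumes C: "lsubspace (C :: ('a \<Rightarrow> 'a) set)"
  shows "lsubspace (code_shift q j C)"
proof (rule ls.subspaceI)
  have "(0 :: 'a \<Rightarrow> 'a) = qshift q j 0"
    by (auto simp: qshift_def)
  then show "0 \<in> code_shift q j C" using ls.subspace_0[OF C] by (auto simp: code_shift_def)
next
  fix x y assume "x \<in> code_shift q j C" "y \<in> code_shift q j C"
  then obtain u v where "x = qshift q j u" "y = qshift q j v" "u \<in> C" "v \<in> C"
    by (auto simp: code_shift_def)
  moreover have "qshift q j u + qshift q j v = qshift q j (u + v)"
    by (auto simp: qshift_def frob_add)
  ultimately show "x + y \<in> code_shift q j C"
    using ls.subspace_add[OF C] by (simp add: code_shift_def)
next
  fix c :: 'a and x assume "x \<in> code_shift q j C"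
  then obtain u where u: "x = qshift q j u" "u \<in> C"
    by (auto simp: code_shift_def)
  obtain d where "c = frob q j d"
    using surjD[OF bij_is_surj[OF bij_frob[of j]], of c] by blast
  then have "lscale c x = qshift q j (lscale d u)"
    by (auto simp: u(1) qshift_def frob_mult)
  then show "lscale c x \<in> code_shift q j C"
    using ls.subspace_scale[OF C u(2)] by (simp add: code_shift_def)
qed

text \<open>Reducing \<open>j\<close> modulo \<open>n\<close> brings it into the range of the
  maximum, and coprimality with \<open>2 \<le> n\<close> keeps it nonzero. So any coprime exponent
  may be used, in particular \<open>s\<close> itself.\<close>

lemma h_val_ge:
  assumes "2 \<le> n" "coprime j n"
  shows "ldim (C \<inter> code_shift q j C :: ('a \<Rightarrow> 'a) set) \<le> h_val q n C"
proof -
  have "coprime (j mod n) n" using assms(2) n_pos by (simp only: coprime_mod_left_iff)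
  moreover from this have "j mod n \<noteq> 0" using assms(1) by (intro notI) simp
  moreover have "j mod n \<le> n - 1" using n_pos by (metis Suc_pred' less_Suc_eq_le mod_less_divisor)
  moreover have "code_shift q (j mod n) C = code_shift q j C"
    unfolding code_shift_def qshift_def by (simp add: frob_mod)
  ultimately show ?thesis
    unfolding h_val_def by (intro Max_ge) (auto simp: Suc_le_eq intro!: exI[of _ "j mod n"])
qed

end

context galois_gen
begin

text \<open>Every generator of the Galois group is a power of the generator \<open>T 1\<close>, so
  results about all coprime shifts can be proved in the coordinates belonging to
  \<open>s\<close>.\<close>

lemma coprime_exponent:
  assumes "coprime t n" "2 \<le> n"
  obtains j where "1 \<le> j" "j < n" "coprime j n" "\<And>i. frob q (t * i) = T (j * i)"
proof -
  obtain r where r: "\<And>i. (s * (r * i mod n)) mod n = i mod n" "coprime r n"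
    using inverse_exponent by metis
  show ?thesis
  proof
    show "coprime (r * t mod n) n" using r(2) assms(1) n_pos by (simp only: coprime_mod_left_iff coprime_mult_left_iff)
    then show "1 \<le> r * t mod n" using assms(2) by (cases "r * t mod n") auto
    show "r * t mod n < n" using n_pos by simp
    show "frob q (t * i) = T (r * t mod n * i)" for i
      unfolding T_def
    proof (rule frob_cong)
      have "[t = s * (r * t mod n)] (mod n)" by (simp add: cong_def r(1))
      then show "[t * i = s * (r * t mod n * i)] (mod n)"
        using cong_scalar_right[of t "s * (r * t mod n)" n i] by (simp only: mult.assoc)
    qed
  qed
qed

lemma h_val_le:
  assumes "2 \<le> n"
    and "\<And>j. 1 \<le> j \<Longrightarrow> j < n \<Longrightarrow> coprime j n \<Longrightarrow> ldim (C \<inter> code_shift q (s * j) C) \<le> d"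
  shows "h_val q n (C :: ('a \<Rightarrow> 'a) set) \<le> d"
proof -
  have "ldim (C \<inter> code_shift q t C) \<le> d" if t: "coprime t n" for t
  proof -
    obtain j where j: "1 \<le> j" "j < n" "coprime j n" "\<And>i. frob q (t * i) = T (j * i)"
      using coprime_exponent[OF t assms(1)] by metis
    have "code_shift q t C = code_shift q (s * j) C"
      unfolding code_shift_def qshift_def using j(4)[of 1] by (simp add: T_def)
    with assms(2) j show ?thesis by simp
  qed
  moreover have "\<exists>j. 1 \<le> j \<and> j \<le> n - 1 \<and> coprime j n"
    using assms(1) by (intro exI[of _ 1]) auto
  ultimately show ?thesis
    unfolding h_val_def by (intro Max.boundedI) (auto simp: setcompr_eq_image)
qed

lemma coef_comp_T:
  assumes "f \<in> qpolys"
  shows "coef (f \<circ> T j) (i + j) = coef f i"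
proof -
  have "f \<circ> T j = (\<Sum>k<n. lscale (coef f k) (T (k + j)))"
    by (subst qpoly_coef[OF assms, symmetric]) (simp add: qpoly_def fun_eq_iff sum_apply T_add)
  then have "coef (f \<circ> T j) (i + j) = (\<Sum>k<n. coef f k * coef (T (k + j)) (i + j))"
    by (simp add: coef_sum coef_scale)
  also have "\<dots> = (\<Sum>k<n. if k = i mod n then coef f k else 0)"
  proof (rule sum.cong)
    fix k assume "k \<in> {..<n}"
    then have "[i + j = k + j] (mod n) \<longleftrightarrow> k = i mod n"
      unfolding cong_add_rcancel_nat by (auto simp: cong_def)
    then show "coef f k * coef (T (k + j)) (i + j) = (if k = i mod n then coef f k else 0)"
      by (simp add: coef_T cong_def)
  qed simp
  finally show ?thesis using n_pos by (simp add: coef_mod)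
qed

text \<open>Taking \<open>i = 0\<close> puts \<open>m\<close> itself into the code, so its
  coefficients from index \<open>l\<close> on vanish. For \<open>0 < i < l\<close>, composing with
  \<open>T (l - i)\<close> moves coefficient \<open>i\<close> to index \<open>l\<close>, which
  exists since \<open>l < n\<close> and lies outside the code.\<close>

lemma scalar_if_in_gab_idealizer:
  assumes l: "0 < l" "l < n" and m: "\<And>i. i < l \<Longrightarrow> m \<circ> T i \<in> lspan (T ` {..<l})"
  shows "m = lscale (coef m 0) id"
proof -
  have gab: "f \<in> lspan (T ` {..<l}) \<longleftrightarrow> f \<in> qpolys \<and> (\<forall>i<n. l \<le> i \<longrightarrow> coef f i = 0)" for f
    using l by (subst in_span_monomials_iff) auto
  have "m \<in> qpolys" "\<forall>i<n. l \<le> i \<longrightarrow> coef m i = 0"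
    using m[of 0] l by (simp_all add: gab T_0)
  moreover have "coef m i = 0" if "0 < i" "i < l" for i
  proof -
    have "coef (m \<circ> T (l - i)) (i + (l - i)) = 0"
      using m[of "l - i"] that l by (simp add: gab)
    then show ?thesis using coef_comp_T[OF \<open>m \<in> qpolys\<close>] by simp
  qed
  ultimately have m: "m \<in> qpolys" "\<And>i. 0 < i \<Longrightarrow> i < n \<Longrightarrow> coef m i = 0"
    by (metis not_le)+
  have T0: "lscale (coef m 0) (T 0) \<in> qpolys"
    by (intro qpolys_closed T_in_qpolys)
  have "m = lscale (coef m 0) (T 0)"
  proof (rule qpolys_eqI[OF m(1) T0])
    fix i assume "i < n"
    then have "coef (T 0) i = (if i = 0 then 1 else 0)"
      by (subst coef_T) simp
    then show "coef m i = coef (lscale (coef m 0) (T 0)) i"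
      using m(2) \<open>i < n\<close> by (subst coef_scale[OF T_in_qpolys]) auto
  qed
  then show ?thesis by (simp add: T_0)
qed

text \<open>
  An equivalence \<open>f \<mapsto> h \<circ> f\<^sup>\<sigma> \<circ> g\<close> onto a Gabidulin code transports multiplication by \<open>\<alpha>\<close> on \<open>G\<close>
  to a left multiplication preserving the Gabidulin code, which is again a scalar. Hence
  \<open>\<sigma>\<^sup>-\<^sup>1 \<circ> h\<^sup>-\<^sup>1\<close> is a multiplicative map up to a constant, and so commutes with Frobenius powers.
\<close>

lemma equiv_gab_imp_orbit:
  assumes equiv: "code_equiv q G (gab q l s)" and G: "lsubspace G" "ldim G < n"
  shows "\<exists>g. bij g \<and> (\<forall>i<ldim G. T i \<circ> g \<in> G)"
proof -
  obtain h g\<^sub>0 \<sigma> :: "'a \<Rightarrow> 'a" where bij: "bij h" "bij g\<^sub>0" "bij \<sigma>"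
    and im: "(\<lambda>f. h \<circ> aut_act \<sigma> f \<circ> g\<^sub>0) ` G = gab q l s"
    using equiv unfolding code_equiv_def field_aut_def by blast
  define \<Phi> where "\<Phi> f = h \<circ> aut_act \<sigma> f \<circ> g\<^sub>0" for f
  define u v where "u = inv \<sigma> \<circ> inv h" and "v = inv g\<^sub>0 \<circ> \<sigma>"
  note [simp] = bij_is_inj[OF bij(1)] bij_is_inj[OF bij(2)] bij_is_inj[OF bij(3)]
    bij_is_surj[OF bij(1)] bij_is_surj[OF bij(2)] bij_is_surj[OF bij(3)] surj_f_inv_f
  have bij_uv: "bij u" "bij v"
    by (simp_all add: u_def v_def bij_comp bij bij_imp_bij_inv)
  have u\<Phi>v: "u \<circ> \<Phi> f \<circ> v = f" for f
    by (simp add: fun_eq_iff u_def v_def \<Phi>_def aut_act_def)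
  then have "inj_on \<Phi> G"
    by (rule inj_on_inverseI[where g = "\<lambda>p. u \<circ> p \<circ> v"])
  then have card: "card G = card (gab q l s :: ('a \<Rightarrow> 'a) set)"
    using card_image[of \<Phi> G] im by (simp add: \<Phi>_def[abs_def])
  have gab_sub: "lsubspace (gab q l s :: ('a \<Rightarrow> 'a) set)"
    by (simp add: gab_def ls.subspace_span)
  have dim: "ldim G = ldim (gab q l s :: ('a \<Rightarrow> 'a) set)"
    using G(1) gab_sub card by (rule ldim_eq_if_card_eq)
  have "l < n"
  proof (rule ccontr)
    \<comment> \<open>A larger \<open>l\<close> only repeats monomials modulo \<open>n\<close>, so
      the code would be the full space of dimension \<open>n\<close>.\<close>
    assume "\<not> l < n"
    then have "gab q n s \<subseteq> (gab q l s :: ('a \<Rightarrow> 'a) set)"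
      unfolding gab_def by (intro ls.span_mono) auto
    then have "ldim (gab q n s :: ('a \<Rightarrow> 'a) set) \<le> ldim (gab q l s :: ('a \<Rightarrow> 'a) set)"
      using gab_sub by (intro ldim_mono) (simp_all add: gab_def ls.subspace_span)
    with dim G(2) show False
      using ldim_span_monomials[of "{..<n}"] by (simp add: gab_eq)
  qed
  then have gab: "gab q l s = lspan (T ` {..<l})" and ldim_G: "ldim G = l"
    using ldim_span_monomials[of "{..<l}"] by (auto simp: gab_eq dim)
  show ?thesis
  proof (cases "l = 0")
    \<comment> \<open>The orbit condition is vacuous, so any bijection will do; the idealizer
      argument below needs \<open>0 < l\<close>.\<close>
    case True
    then show ?thesis using ldim_G by (auto intro!: exI[of _ id])
  next
    case False
    \<comment> \<open>\<open>h \<circ> \<sigma>\<close> is the inverse of \<open>u\<close>, so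
      \<open>M \<alpha>\<close> is multiplication by \<alpha> conjugated by
      \<open>u\<close>.\<close>
    define M where "M \<alpha> = h \<circ> \<sigma> \<circ> (\<lambda>x. \<alpha> * u x)" for \<alpha>
    have uM: "u (M \<alpha> x) = \<alpha> * u x" for \<alpha> x
      by (simp add: M_def u_def)
    have "M \<alpha> \<circ> T i \<in> lspan (T ` {..<l})" if "i < l" for \<alpha> i
    proof -
      have "T i \<in> \<Phi> ` G"
        using that im by (simp add: \<Phi>_def[abs_def] gab ls.span_base)
      then obtain f where f: "f \<in> G" "T i = \<Phi> f" by blast
      have "M \<alpha> \<circ> T i = \<Phi> (lscale \<alpha> f)"
        by (simp add: f(2) fun_eq_iff M_def \<Phi>_def u_def aut_act_def)
      also have "\<dots> \<in> \<Phi> ` G"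
        using ls.subspace_scale[OF G(1) f(1)] by simp
      finally show ?thesis using im by (simp add: \<Phi>_def[abs_def] gab)
    qed
    then have "\<exists>c. M \<alpha> = lscale c id" for \<alpha>
      using scalar_if_in_gab_idealizer[of l "M \<alpha>"] False \<open>l < n\<close> by blast
    then obtain \<phi> where "\<And>\<alpha>. M \<alpha> = lscale (\<phi> \<alpha>) id" by metis
    then have u_\<phi>: "u (\<phi> \<alpha> * x) = \<alpha> * u x" for \<alpha> x
      using uM[of \<alpha> x] by simp
    have "u 0 = 0" using u_\<phi>[of 0 0] by simp
    then have u1: "u 1 \<noteq> 0" using injD[OF bij_is_inj[OF bij_uv(1)], of 1 0] by auto
    \<comment> \<open>Dividing by \<open>u 1\<close> normalizes \<open>u\<close> to fix 1 and makes
      it inverse to \<open>\<phi>\<close>. Multiplicativity alone, without additivity, makes it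
      commute with power maps and thus with Frobenius.\<close>
    define \<tau> where "\<tau> y = u y / u 1" for y
    have "\<phi> (\<tau> y) = y" for y
    proof -
      have "u (\<phi> (\<tau> y)) = u y"
        using u_\<phi>[of "\<tau> y" 1] u1 by (simp add: \<tau>_def)
      then show ?thesis by (rule injD[OF bij_is_inj[OF bij_uv(1)]])
    qed
    then have \<tau>_mult: "\<tau> (y * x) = \<tau> y * \<tau> x" for x y
      using u_\<phi>[of "\<tau> y" x] by (simp add: \<tau>_def)
    have "\<tau> 1 = 1" using u1 by (simp add: \<tau>_def)
    then have "\<tau> (y ^ m) = \<tau> y ^ m" for y m
      by (induction m) (simp_all add: \<tau>_mult)
    then have \<tau>_frob: "\<tau> (frob q m y) = frob q m (\<tau> y)" for m y
      by (simp add: frob_apply)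
    have "bij \<tau>"
    proof -
      have "bij (\<lambda>y. y / u 1)"
        by (rule o_bij[of "\<lambda>y. y * u 1"]) (use u1 in \<open>auto simp: fun_eq_iff\<close>)
      then have "bij ((\<lambda>y. y / u 1) \<circ> u)" using bij_uv(1) by (simp add: bij_comp)
      then show ?thesis by (simp add: \<tau>_def[abs_def] comp_def)
    qed
    then have "bij (\<tau> \<circ> v)" using bij_uv(2) by (simp add: bij_comp)
    \<comment> \<open>Moving \<open>\<tau>\<close> past \<open>T i\<close> turns the transported
      monomial \<open>u \<circ> T i \<circ> v\<close> into an orbit element, up to the scalar
      \<open>1 / u 1\<close>.\<close>
    moreover have "T i \<circ> (\<tau> \<circ> v) \<in> G" if "i < l" for i
    proof -
      have "T i \<in> \<Phi> ` G"
        using that im by (simp add: \<Phi>_def[abs_def] gab ls.span_base)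
      then have "u \<circ> T i \<circ> v \<in> G" using u\<Phi>v by auto
      moreover have "T i \<circ> (\<tau> \<circ> v) = lscale (1 / u 1) (u \<circ> T i \<circ> v)"
        by (simp add: fun_eq_iff T_def \<tau>_frob[symmetric]) (simp add: \<tau>_def)
      ultimately show ?thesis using ls.subspace_scale[OF G(1)] by simp
    qed
    ultimately show ?thesis using ldim_G by blast
  qed
qed

text \<open>Right composition with \<open>inv g\<close> is an equivalence that carries the span of
  the orbit back to a Gabidulin code.\<close>

lemma orbit_gen_gab:
  assumes C: "lsubspace C" and g: "bij g" "fq_linear q g"
    and d: "d \<le> n" "\<And>i. i < d \<Longrightarrow> T i \<circ> g \<in> C"
  shows "\<exists>G. ldim G = d \<and> G \<subseteq> C \<and> lsubspace G \<and> gen_gab q n G"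
proof -
  define G where "G = (\<lambda>f. f \<circ> g) ` gab q d s"
  have gab: "gab q d s = lspan (T ` {..<d})" using d(1) by (rule gab_eq)
  have sub: "lsubspace (gab q d s :: ('a \<Rightarrow> 'a) set)" by (simp add: gab_def ls.subspace_span)
  have "ldim G = d"
    unfolding G_def using sub g(1) d(1) ldim_span_monomials[of "{..<d}"]
    by (simp add: ldim_comp_right bij_is_surj gab)
  moreover have "G \<subseteq> C"
    unfolding G_def gab using span_comp_right_subset[OF C, of "T ` {..<d}" g] d(2) by blast
  moreover have "lsubspace G" unfolding G_def by (rule lsubspace_comp_right[OF sub])
  moreover have "gen_gab q n G"
  proof -
    have "fq_linear q (inv g)"
      unfolding fq_linear_def
    proof (intro conjI allI ballI)
      fix x y :: 'a show "inv g (x + y) = inv g x + inv g y"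
        using g by (intro inv_f_eq) (auto simp: fq_linear_def bij_is_inj surj_f_inv_f[OF bij_is_surj])
    next
      fix c x :: 'a assume "c \<in> Fq q" then show "inv g (c * x) = c * inv g x"
        using g by (intro inv_f_eq) (auto simp: fq_linear_def bij_is_inj surj_f_inv_f[OF bij_is_surj])
    qed
    moreover have "bij (inv g)" using g(1) by (rule bij_imp_bij_inv)
    moreover have "fq_linear q (id :: 'a \<Rightarrow> 'a)" "field_aut (id :: 'a \<Rightarrow> 'a)"
      by (auto simp: fq_linear_def field_aut_def)
    moreover have "(\<lambda>f. id \<circ> aut_act id f \<circ> inv g) ` G = gab q d s"
      by (simp add: G_def image_image aut_act_def comp_assoc surj_iff[THEN iffD1] bij_is_surj g(1))
    ultimately have "code_equiv q G (gab q d s)"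
      unfolding code_equiv_def by (metis bij_id)
    then show ?thesis using coprime_s by (auto simp: gen_gab_def)
  qed
  ultimately show ?thesis by blast
qed

lemma gab_index_ge:
  assumes "lsubspace C" "bij g" "fq_linear q g" "d \<le> n" "\<And>i. i < d \<Longrightarrow> T i \<circ> g \<in> C"
  shows "d \<le> gab_index q n C"
proof -
  obtain G where "ldim G = d" "G \<subseteq> C \<and> lsubspace G \<and> gen_gab q n G"
    using orbit_gen_gab[OF assms] by blast
  then show ?thesis
    unfolding gab_index_def by (intro Max_ge) (auto simp: setcompr_eq_image)
qed

end

context frob_field
begin

text \<open>A Gabidulin subspace of dimension above \<open>d\<close> comes with its own exponent
  \<open>t\<close> and contains an orbit of length \<open>d + 1\<close> for it, so orbits have to be
  excluded for all coprime \<open>t\<close>.\<close>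

lemma gab_index_le:
  assumes C: "lsubspace C" "ldim C < n"
    and *: "\<And>g t. bij g \<Longrightarrow> coprime t n \<Longrightarrow> (\<And>i. i \<le> d \<Longrightarrow> frob q (t * i) \<circ> g \<in> C) \<Longrightarrow> False"
  shows "gab_index q n (C :: ('a \<Rightarrow> 'a) set) \<le> d"
proof -
  interpret one: galois_gen q n F 1 by unfold_locales simp
  have "ldim G \<le> d" if G: "G \<subseteq> C" "lsubspace G" "gen_gab q n G" for G
  proof (rule ccontr)
    assume "\<not> ldim G \<le> d"
    obtain l t where t: "coprime t n" "code_equiv q G (gab q l t)"
      using G(3) by (auto simp: gen_gab_def)
    interpret t: galois_gen q n F t by unfold_locales (rule t(1))
    have "ldim G < n" using ldim_mono[OF G(2) C(1) G(1)] C(2) by simp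
    then obtain g where g: "bij g" "\<And>i. i < ldim G \<Longrightarrow> t.T i \<circ> g \<in> G"
      using t.equiv_gab_imp_orbit[OF t(2) G(2)] by blast
    show False
      by (rule *[OF g(1) t(1)]) (use g(2) G(1) \<open>\<not> ldim G \<le> d\<close> in \<open>auto simp: t.T_def\<close>)
  qed
  \<comment> \<open>The maximum needs a nonempty set; the orbit of length 0 supplies the zero
    space.\<close>
  moreover have "\<exists>G. G \<subseteq> C \<and> lsubspace G \<and> gen_gab q n G"
    using one.orbit_gen_gab[OF C(1), of id 0] by (auto simp: fq_linear_def)
  ultimately show ?thesis
    unfolding gab_index_def by (intro Max.boundedI) (auto simp: setcompr_eq_image)
qed

text \<open>An orbit of length h + 2 would put its last h + 1 members into \<open>C\<close> and, as
  shifts of their predecessors, into the shifted code as well, exceeding the maximum h.\<close>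

lemma gab_index_le_Suc_h_val:
  assumes n: "2 \<le> n" and C: "lsubspace C" "ldim C < n"
  shows "gab_index q n (C :: ('a \<Rightarrow> 'a) set) \<le> h_val q n C + 1"
proof (rule gab_index_le[OF C])
  fix g t assume g: "bij g" and t: "coprime t n"
    and *: "\<And>i. i \<le> h_val q n C + 1 \<Longrightarrow> frob q (t * i) \<circ> g \<in> C"
  interpret t: galois_gen q n F t by unfold_locales (rule t)
  have dim: "card D \<le> ldim S"
    if "D \<subseteq> {..<n}" "lsubspace S" "\<And>i. i \<in> D \<Longrightarrow> frob q (t * i) \<circ> g \<in> S" for D S
  proof -
    have "(\<lambda>f. f \<circ> g) ` lspan (t.T ` D) \<subseteq> S"
      using span_comp_right_subset[OF that(2), of "t.T ` D" g] that(3) by (auto simp: t.T_def)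
    then have "ldim ((\<lambda>f. f \<circ> g) ` lspan (t.T ` D)) \<le> ldim S"
      by (intro ldim_mono lsubspace_comp_right ls.subspace_span that(2))
    also have "ldim ((\<lambda>f. f \<circ> g) ` lspan (t.T ` D)) = card D"
      using t.ldim_span_monomials[OF that(1)] by (simp only: ldim_comp_right[OF ls.subspace_span bij_is_surj[OF g]])
    finally show ?thesis .
  qed
  \<comment> \<open>Otherwise the orbit would run through all residues modulo \<open>n\<close> and
    span an \<open>n\<close>-dimensional part of \<open>C\<close>. The bound makes the exponents
    \<open>1, ..., h + 1\<close> distinct residues.\<close>
  have less: "h_val q n C + 1 < n"
    using dim[of "{..<n}" C] C * by (force simp: not_less)
  have "frob q (t * i) \<circ> g \<in> C \<inter> code_shift q t C" if i: "i \<in> {1..h_val q n C + 1}" for i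
  proof
    obtain k where "i = Suc k" using i by (cases i) auto
    then have "frob q (t * i) \<circ> g = qshift q t (frob q (t * k) \<circ> g)"
      by (simp add: qshift_def fun_eq_iff frob_frob)
    then show "frob q (t * i) \<circ> g \<in> code_shift q t C"
      using * i \<open>i = Suc k\<close> by (simp add: code_shift_def)
  qed (use * i in auto)
  then have "h_val q n C + 1 \<le> ldim (C \<inter> code_shift q t C)"
    using dim[of "{1..h_val q n C + 1}" "C \<inter> code_shift q t C"] less C(1)
    by (auto simp: ls.subspace_inter subspace_code_shift subset_iff)
  then show False
    using h_val_ge[OF n t, of C] by simp
qed

end

subsection \<open>Bounds for both invariants\<close>

context galois_gen
begin

lemma coef_T_comp_sub:
  assumes "f \<in> qpolys"
  shows "coef (T j \<circ> f) i = T j (coef f ((i + (n - j mod n)) mod n))"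
proof -
  have "[(i + (n - j mod n)) mod n + j = i + (n - j mod n) + j mod n] (mod n)"
    by (simp only: cong_def mod_simps)
  also have "i + (n - j mod n) + j mod n = i + n"
    using mod_less_divisor[OF n_pos, of j] by linarith
  finally have "[(i + (n - j mod n)) mod n + j = i] (mod n)"
    by (simp add: cong_def)
  then show ?thesis
    using coef_T_comp[OF assms, of j "(i + (n - j mod n)) mod n"] coef_cong by metis
qed

text \<open>Members of the intersection are \<open>T j \<circ> g\<close> with both \<open>g\<close>
  and \<open>T j \<circ> g\<close> in \<open>C\<close>. The condition is stated on \<open>g\<close>,
  so the coordinates that determine \<open>T j \<circ> g\<close> are those of \<open>I\<close> moved
  by \<open>j\<close>.\<close>

lemma ldim_inter_shift_le:
  assumes C: "lsubspace C" "C \<subseteq> qpolys" and I: "finite I"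
    and *: "\<And>g i. g \<in> C \<Longrightarrow> T j \<circ> g \<in> C \<Longrightarrow> (\<And>i. i \<in> I \<Longrightarrow> coef g i = 0) \<Longrightarrow> i < n \<Longrightarrow> coef g i = 0"
  shows "ldim (C \<inter> code_shift q (s * j) C) \<le> card I"
proof -
  have "ldim (C \<inter> code_shift q (s * j) C) \<le> card ((\<lambda>i. i + j) ` I)"
  proof (rule ldim_le)
    fix f assume f: "f \<in> C \<inter> code_shift q (s * j) C" "\<And>i. i \<in> (\<lambda>i. i + j) ` I \<Longrightarrow> coef f i = 0"
    then obtain g where g: "g \<in> C" "f = T j \<circ> g"
      by (auto simp: code_shift_def qshift_def T_def[abs_def])
    then have "g \<in> qpolys" using C(2) by auto
    have "coef g i = 0" if "i \<in> I" for i
      using f(2)[of "i + j"] that coef_T_comp[OF \<open>g \<in> qpolys\<close>] by (simp add: g(2))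
    then have "g = 0"
      using * g f(1) by (intro qpolys_eqI[OF \<open>g \<in> qpolys\<close>]) auto
    then show "f = 0" by (auto simp: g(2))
  qed (use C I in \<open>auto simp: ls.subspace_inter subspace_code_shift\<close>)
  also have "\<dots> \<le> card I" by (rule card_image_le[OF I])
  finally show ?thesis .
qed

text \<open>Vanishing of all coefficients means \<open>g = 0\<close>, which is not
  bijective.\<close>

lemma gab_index_le_if_no_orbit:
  assumes n: "2 \<le> n" and C: "lsubspace C" "C \<subseteq> qpolys" "ldim C < n"
    and *: "\<And>g j i. 1 \<le> j \<Longrightarrow> j < n \<Longrightarrow> coprime j n \<Longrightarrow> (\<And>i. i \<le> d \<Longrightarrow> T (j * i) \<circ> g \<in> C) \<Longrightarrow>
      i < n \<Longrightarrow> coef g i = 0"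
  shows "gab_index q n C \<le> d"
proof (rule gab_index_le[OF C(1,3)])
  fix g t assume g: "bij g" and t: "coprime t n" and orbit: "\<And>i. i \<le> d \<Longrightarrow> frob q (t * i) \<circ> g \<in> C"
  obtain j where j: "1 \<le> j" "j < n" "coprime j n" "\<And>i. frob q (t * i) = T (j * i)"
    using coprime_exponent[OF t n] by metis
  have "g \<in> qpolys" using orbit[of 0] C(2) by auto
  moreover have "coef g i = 0" if "i < n" for i
    using *[OF j(1-3) _ that, of g] orbit by (simp add: j(4))
  ultimately have "g = 0" by (intro qpolys_eqI) auto
  then have "g 0 = g 1" by simp
  with g show False by (simp add: bij_is_inj inj_eq)
qed

text \<open>The chain \<open>Suc d\<close> \<le> ind \<le> h + 1 \<le> \<open>Suc d\<close>
  collapses.\<close>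

lemma gab_index_h_val_eqI:
  assumes "2 \<le> n" "lsubspace C" "ldim C < n" "h_val q n C \<le> d" "Suc d \<le> gab_index q n C"
  shows "gab_index q n (C :: ('a \<Rightarrow> 'a) set) = Suc d \<and> h_val q n C = d"
  using gab_index_le_Suc_h_val[OF assms(1-3)] assms(4,5) by simp

section \<open>Monomial codes and cyclic differences\<close>

lemma monomials_le_gab_index:
  assumes "lsubspace C" "d \<le> n" "\<And>i. i < d \<Longrightarrow> T (a + i) \<in> C"
  shows "d \<le> gab_index q n C"
proof (rule gab_index_ge[where g = "T a"])
  show "bij (T a)" "fq_linear q (T a)"
    unfolding T_def by (rule bij_frob, rule fq_linear_frob)
qed (use assms in \<open>simp_all add: T_comp add.commute\<close>)

lemma ldim_span_list: "ldim (lspan (set xs) :: ('a \<Rightarrow> 'a) set) \<le> length xs"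
  using ls.dim_le_card[of "lspan (set xs)" "set xs"] card_length[of xs] by simp

text \<open>A coefficient of \<open>g\<close> survives only if its index and the shifted index both
  belong to \<open>D\<close>.\<close>

lemma ldim_monomials_inter_shift_le:
  assumes D: "D \<subseteq> {..<n}"
  shows "ldim (lspan (T ` D) \<inter> code_shift q (s * j) (lspan (T ` D)))
    \<le> card {i \<in> D. (i + j) mod n \<in> D}"
proof (rule ldim_inter_shift_le)
  show "finite {i \<in> D. (i + j) mod n \<in> D}"
    using D finite_subset by fastforce
next
  fix g i
  assume g: "g \<in> lspan (T ` D)" "T j \<circ> g \<in> lspan (T ` D)" "i < n"
    and 0: "\<And>i. i \<in> {i \<in> D. (i + j) mod n \<in> D} \<Longrightarrow> coef g i = 0"
  have "g \<in> qpolys" "T j \<circ> g \<in> qpolys"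
    using g in_span_monomials_iff[OF D] by auto
  consider "i \<notin> D" | "i \<in> D" "(i + j) mod n \<in> D" | "(i + j) mod n \<notin> D" by blast
  then show "coef g i = 0"
  proof cases
    case 3
    then have "coef (T j \<circ> g) ((i + j) mod n) = 0"
      using g(2) n_pos by (simp add: in_span_monomials_iff[OF D])
    then show ?thesis
      using coef_T_comp[OF \<open>g \<in> qpolys\<close>, of j i] by (simp add: coef_mod)
  qed (use g 0 in \<open>auto simp: in_span_monomials_iff[OF D]\<close>)
qed (use span_monomials_qpolys ls.subspace_span in auto)

text \<open>The claim becomes combinatorial: every coprime \<open>j\<close> occurs at most
  \<open>d\<close> times as a cyclic difference in \<open>D\<close>, and \<open>D\<close> contains
  \<open>d + 1\<close> consecutive indices starting at \<open>a\<close>.\<close>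

lemma monomials_index_h_val:
  assumes n: "2 \<le> n" and D: "D \<subseteq> {..<n}" "card D < n"
    and le: "\<And>j. 1 \<le> j \<Longrightarrow> j < n \<Longrightarrow> coprime j n \<Longrightarrow> card {i \<in> D. (i + j) mod n \<in> D} \<le> d"
    and ge: "Suc d \<le> n" "\<forall>i\<le>d. a + i \<in> D"
  shows "gab_index q n (lspan (T ` D)) = Suc d \<and> h_val q n (lspan (T ` D)) = d"
proof (rule gab_index_h_val_eqI[OF n ls.subspace_span])
  show "ldim (lspan (T ` D)) < n" using D by (simp only: ldim_span_monomials)
  show "h_val q n (lspan (T ` D)) \<le> d"
    by (intro h_val_le[OF n] order_trans[OF ldim_monomials_inter_shift_le[OF D(1)] le])
  show "Suc d \<le> gab_index q n (lspan (T ` D))"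
    using ge by (intro monomials_le_gab_index[where a = a] ls.subspace_span) (auto intro: ls.span_base)
qed

lemma gab_index_h_val_gab:
  assumes k: "1 \<le> k" "k < n"
  shows "gab_index q n (lspan (T ` {..<k})) = k \<and> h_val q n (lspan (T ` {..<k})) = k - 1"
proof -
  have "card {i \<in> {..<k}. (i + j) mod n \<in> {..<k}} \<le> k - 1" if j: "1 \<le> j" "j < n" for j
  proof -
    \<comment> \<open>For \<open>j \<le> k\<close> the index \<open>k - j\<close> moves to
      \<open>k\<close>. For larger \<open>j\<close> truncated subtraction gives 0, which moves to
      \<open>j\<close>, also outside.\<close>
    have "k - j \<notin> {i \<in> {..<k}. (i + j) mod n \<in> {..<k}} \<and> k - j \<in> {..<k}"
      using j k by (cases "j \<le> k") auto
    then have "{i \<in> {..<k}. (i + j) mod n \<in> {..<k}} \<subset> {..<k}" by blast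
    then have "card {i \<in> {..<k}. (i + j) mod n \<in> {..<k}} < k"
      using psubset_card_mono[of "{..<k}"] by simp
    then show ?thesis by simp
  qed
  moreover have "{..<k} \<subseteq> {..<n}" "\<forall>i\<le>k - 1. 0 + i \<in> {..<k}" using k by auto
  ultimately show ?thesis
    using monomials_index_h_val[of "{..<k}" "k - 1" 0] k by simp
qed

text \<open>Modulo 7, \<open>{0, 1, 3}\<close> is the difference set of the Fano plane, with every
  nonzero difference occurring once; in \<open>{0, 2, 3, 4}\<close> each occurs twice. The runs 0, 1
  and 2, 3, 4 provide the orbits.\<close>

lemma monomials_7:
  assumes n: "n = 7"
  shows "gab_index q n (lspan (T ` {0, 1, 3})) = 2 \<and> h_val q n (lspan (T ` {0, 1, 3})) = 1"
    and "gab_index q n (lspan (T ` {0, 2, 3, 4})) = 3 \<and> h_val q n (lspan (T ` {0, 2, 3, 4})) = 2"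
proof -
  have "card {i \<in> {0, 1, 3}. (i + j) mod n \<in> {0, 1, 3}} \<le> 1 \<and>
    card {i \<in> {0, 2, 3, 4}. (i + j) mod n \<in> {0, 2, 3, 4}} \<le> 2" if "1 \<le> j" "j < n" for j
  proof -
    have "j = 1 \<or> j = 2 \<or> j = 3 \<or> j = 4 \<or> j = 5 \<or> j = 6"
      using that n by linarith
    then show ?thesis
      unfolding n conj_Collect_insert by (elim disjE) simp_all
  qed
  note * = this[THEN conjunct1] this[THEN conjunct2]
  have le: "i \<le> Suc 0 \<longleftrightarrow> i = 0 \<or> i = 1" "i \<le> 2 \<longleftrightarrow> i = 0 \<or> i = 1 \<or> i = 2" for i :: nat by auto
  show "gab_index q n (lspan (T ` {0, 1, 3})) = 2 \<and> h_val q n (lspan (T ` {0, 1, 3})) = 1"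
    using monomials_index_h_val[OF _ _ _ *(1), of 0] by (simp add: n le)
  show "gab_index q n (lspan (T ` {0, 2, 3, 4})) = 3 \<and> h_val q n (lspan (T ` {0, 2, 3, 4})) = 2"
    using monomials_index_h_val[OF _ _ _ *(2), of 2] by (simp add: n le)
qed

text \<open>Only odd shifts are coprime to 8. Each returns one element of the first set and three of
  the second to the same set; the runs are 0, 1 and 2, 3, 4, 5.\<close>

lemma monomials_8:
  assumes n: "n = 8"
  shows "gab_index q n (lspan (T ` {0, 1, 3})) = 2 \<and> h_val q n (lspan (T ` {0, 1, 3})) = 1"
    and "gab_index q n (lspan (T ` {0, 2, 3, 4, 5})) = 4 \<and> h_val q n (lspan (T ` {0, 2, 3, 4, 5})) = 3"
proof -
  have "card {i \<in> {0, 1, 3}. (i + j) mod n \<in> {0, 1, 3}} \<le> 1 \<and>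
    card {i \<in> {0, 2, 3, 4, 5}. (i + j) mod n \<in> {0, 2, 3, 4, 5}} \<le> 3"
    if "1 \<le> j" "j < n" "coprime j n" for j
  proof -
    have "j = 1 \<or> j = 3 \<or> j = 5 \<or> j = 7"
      using that n coprime_8_cases by simp
    then show ?thesis
      unfolding n conj_Collect_insert by (elim disjE) simp_all
  qed
  note * = this[THEN conjunct1] this[THEN conjunct2]
  have le: "i \<le> Suc 0 \<longleftrightarrow> i = 0 \<or> i = 1" "i \<le> 3 \<longleftrightarrow> i = 0 \<or> i = 1 \<or> i = 2 \<or> i = 3" for i :: nat by auto
  show "gab_index q n (lspan (T ` {0, 1, 3})) = 2 \<and> h_val q n (lspan (T ` {0, 1, 3})) = 1"
    using monomials_index_h_val[OF _ _ _ *(1), of 0] by (simp add: n le)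
  show "gab_index q n (lspan (T ` {0, 2, 3, 4, 5})) = 4 \<and> h_val q n (lspan (T ` {0, 2, 3, 4, 5})) = 3"
    using monomials_index_h_val[OF _ _ _ *(2), of 2] by (simp add: n le)
qed

lemma coef_T_eq: "n = m \<Longrightarrow> coef (T j) i = (if i mod m = j mod m then 1 else 0)"
  by (drule sym) (simp add: coef_T)

text \<open>The separate variable \<open>m\<close> lets simp compute with a numeral modulus while
  \<open>n\<close> stays a locale parameter.\<close>

lemma coef_T_comp_eq:
  "n = m \<Longrightarrow> f \<in> qpolys \<Longrightarrow> coef (T j \<circ> f) i = T j (coef f ((i + (m - j mod m)) mod m))"
  by (drule sym) (simp add: coef_T_comp_sub)

lemmas coef_linear = coef_add coef_scale coef_diff

text \<open>The test set \<open>I j\<close> may vary with the shift, since different coefficients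
  become redundant for different \<open>j\<close>.\<close>

lemma h_val_le_card:
  assumes n: "2 \<le> n" and C: "lsubspace C" "C \<subseteq> qpolys"
    and I: "\<And>j. finite (I j)" "\<And>j. card (I j) \<le> d"
    and *: "\<And>j g i. \<lbrakk>1 \<le> j; j < n; coprime j n; g \<in> C; T j \<circ> g \<in> C; g \<in> qpolys;
      \<forall>i\<in>I j. coef g i = 0; i < n\<rbrakk> \<Longrightarrow> coef g i = 0"
  shows "h_val q n C \<le> d"
proof (rule h_val_le[OF n])
  fix j assume j: "1 \<le> j" "j < n" "coprime j n"
  have "ldim (C \<inter> code_shift q (s * j) C) \<le> card (I j)"
    using * j C by (intro ldim_inter_shift_le I) blast+
  then show "ldim (C \<inter> code_shift q (s * j) C) \<le> d" using I(2)[of j] by simp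
qed

text \<open>The single shift by \<open>T 1\<close> already gives the lower bound, from maps
  \<open>b i\<close> dual to the coordinates in \<open>I\<close> that stay in the code after one
  step.\<close>

lemma card_le_h_val:
  assumes n: "2 \<le> n" and C: "lsubspace C" "C \<subseteq> qpolys" and I: "finite I"
    and b: "\<And>i. i \<in> I \<Longrightarrow> b i \<in> C" "\<And>i. i \<in> I \<Longrightarrow> T 1 \<circ> b i \<in> C"
    and *: "\<And>i j. i \<in> I \<Longrightarrow> j \<in> I \<Longrightarrow> coef (b i) j = (if i = j then 1 else 0)"
  shows "card I \<le> h_val q n C"
proof -
  have q: "b i \<in> qpolys" if "i \<in> I" for i using b(1)[OF that] C(2) by auto
  have "card ((\<lambda>i. i + 1) ` I) \<le> ldim (C \<inter> code_shift q s C)"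
  proof (rule ldim_ge[where b = "\<lambda>i. T 1 \<circ> b (i - 1)"])
    fix i assume "i \<in> (\<lambda>i. i + 1) ` I"
    then obtain k where k: "k \<in> I" "i = k + 1" by auto
    then show "T 1 \<circ> b (i - 1) \<in> C \<inter> code_shift q s C"
      using b by (auto simp: code_shift_def qshift_def T_def[abs_def])
    show "T 1 \<circ> b (i - 1) \<in> qpolys"
      using k by (simp add: T_comp_in_qpolys q)
    fix j assume "j \<in> (\<lambda>i. i + 1) ` I"
    then obtain m where m: "m \<in> I" "j = m + 1" by auto
    show "coef (T 1 \<circ> b (i - 1)) j = (if i = j then 1 else 0)"
      unfolding m k(2) using k m * by (subst coef_T_comp) (auto simp: q)
  qed (use C I in \<open>auto simp: ls.subspace_inter subspace_code_shift\<close>)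
  also have "card ((\<lambda>i. i + 1) ` I) = card I"
    by (rule card_image) simp
  finally show ?thesis
    using h_val_ge[OF n coprime_s, of C] by (rule order_trans)
qed

subsection \<open>The exceptional codes in dimensions 6 and 8\<close>

text \<open>The coprime shifts 1 and 5 move index 4 to the empty index 5 or 3, so coefficient 4
  vanishes and with it the tied coefficient 1. Coefficient 0 goes to index 1, whose tied partner is
  0 after the shift, or to the empty index 5. Hence the intersection is trivial and the empty test
  set suffices.\<close>

lemma binomial_code_6:
  fixes \<delta> :: 'a
  assumes n: "n = 6"
  defines "C \<equiv> lspan {T 0, \<lambda>x. \<delta> * T 1 x + T 4 x}"
  shows "gab_index q n C = 1 \<and> h_val q n C = 0"
proof -
  have "(\<lambda>x. \<delta> * T 1 x + T 4 x) = lscale \<delta> (T 1) + T 4"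
    by (simp add: fun_eq_iff)
  then have C_eq: "C = lspan {T 0, lscale \<delta> (T 1) + T 4}"
    unfolding C_def by (rule arg_cong)
  have C: "lsubspace C" "C \<subseteq> qpolys"
    unfolding C_eq by (rule ls.subspace_span, rule ls.span_minimal[OF _ subspace_qpolys]) simp
  have rel: "coef f 2 = 0 \<and> coef f 3 = 0 \<and> coef f 5 = 0 \<and> coef f 1 = \<delta> * coef f 4"
    if "f \<in> C" for f
    using that unfolding C_eq
    by (rule span_coef_relation[where R = "\<lambda>c. c 2 = 0 \<and> c 3 = 0 \<and> c 5 = 0 \<and> c 1 = \<delta> * c 4"])
      (simp, (auto simp: coef_linear coef_T_eq[OF n])[1], simp_all add: algebra_simps)
  have dim: "ldim C < n"
    using ldim_span_list[of "[T 0, lscale \<delta> (T 1) + T 4]"] by (simp add: n C_eq)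
  have "h_val q n C \<le> 0"
  proof (rule h_val_le_card[OF _ C, where I = "\<lambda>_. {}"])
    fix j g i assume j: "j < n" "coprime j n" and g: "g \<in> C" "T j \<circ> g \<in> C" "g \<in> qpolys" "i < n"
    have "j = 1 \<or> j = 5" using j coprime_6_cases n by simp
    with rel[OF g(1)] rel[OF g(2)] nat_less_7_cases[of i] g(3) g(4)[unfolded n]
    show "coef g i = 0" by (auto simp: coef_T_comp_eq[OF n])
  qed (use n in simp_all)
  moreover have "1 \<le> gab_index q n C"
    by (rule monomials_le_gab_index[OF C(1), where a = 0])
      (use n_pos in \<open>auto simp: C_eq ls.span_base\<close>)
  ultimately show ?thesis
    using gab_index_h_val_eqI[OF _ C(1) dim, of 0] n by simp
qed

text \<open>Shift 1 moves index 1, shift 5 moves index 3, to the empty index 2; the ties then kill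
  all odd coefficients. Coefficient 0 lands on an odd index tied to one that is empty after the
  shift.\<close>

lemma trinomial_code_6:
  fixes \<delta> :: 'a
  assumes n: "n = 6"
  defines "C \<equiv> lspan {T 0, \<lambda>x. T 1 x + T 3 x + \<delta> * T 5 x}"
  shows "gab_index q n C = 1 \<and> h_val q n C = 0"
proof -
  have "(\<lambda>x. T 1 x + T 3 x + \<delta> * T 5 x) = T 1 + T 3 + lscale \<delta> (T 5)"
    by (simp add: fun_eq_iff)
  then have C_eq: "C = lspan {T 0, T 1 + T 3 + lscale \<delta> (T 5)}"
    unfolding C_def by (rule arg_cong)
  have C: "lsubspace C" "C \<subseteq> qpolys"
    unfolding C_eq by (rule ls.subspace_span, rule ls.span_minimal[OF _ subspace_qpolys]) simp
  have rel: "coef f 2 = 0 \<and> coef f 4 = 0 \<and> coef f 3 = coef f 1 \<and> coef f 5 = \<delta> * coef f 1"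
    if "f \<in> C" for f
    using that unfolding C_eq
    by (rule span_coef_relation[where R = "\<lambda>c. c 2 = 0 \<and> c 4 = 0 \<and> c 3 = c 1 \<and> c 5 = \<delta> * c 1"])
      (simp, (auto simp: coef_linear coef_T_eq[OF n])[1], simp_all add: algebra_simps)
  have dim: "ldim C < n"
    using ldim_span_list[of "[T 0, T 1 + T 3 + lscale \<delta> (T 5)]"] by (simp add: n C_eq)
  have "h_val q n C \<le> 0"
  proof (rule h_val_le_card[OF _ C, where I = "\<lambda>_. {}"])
    fix j g i assume j: "j < n" "coprime j n" and g: "g \<in> C" "T j \<circ> g \<in> C" "g \<in> qpolys" "i < n"
    have "j = 1 \<or> j = 5" using j coprime_6_cases n by simp
    with rel[OF g(1)] rel[OF g(2)] nat_less_7_cases[of i] g(3) g(4)[unfolded n]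
    show "coef g i = 0" by (auto simp: coef_T_comp_eq[OF n])
  qed (use n in simp_all)
  moreover have "1 \<le> gab_index q n C"
    by (rule monomials_le_gab_index[OF C(1), where a = 0])
      (use n_pos in \<open>auto simp: C_eq ls.span_base\<close>)
  ultimately show ?thesis
    using gab_index_h_val_eqI[OF _ C(1) dim, of 0] n by simp
qed

text \<open>Every odd shift moves index 1 or index 5 to an empty index, and \<delta> \<noteq> 0
  passes the vanishing on to the other one. Coefficient 0 then lands on an empty index or on one
  whose partner is 0.\<close>

lemma binomial_code_8:
  fixes \<delta> :: 'a
  assumes n: "n = 8" and \<delta>: "\<delta> \<noteq> 0"
  defines "C \<equiv> lspan {T 0, \<lambda>x. \<delta> * T 1 x + T 5 x}"
  shows "gab_index q n C = 1 \<and> h_val q n C = 0"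
proof -
  have "(\<lambda>x. \<delta> * T 1 x + T 5 x) = lscale \<delta> (T 1) + T 5"
    by (simp add: fun_eq_iff)
  then have C_eq: "C = lspan {T 0, lscale \<delta> (T 1) + T 5}"
    unfolding C_def by (rule arg_cong)
  have C: "lsubspace C" "C \<subseteq> qpolys"
    unfolding C_eq by (rule ls.subspace_span, rule ls.span_minimal[OF _ subspace_qpolys]) simp
  have rel: "coef f 2 = 0 \<and> coef f 3 = 0 \<and> coef f 4 = 0 \<and> coef f 6 = 0 \<and> coef f 7 = 0 \<and> coef f 1 = \<delta> * coef f 5"
    if "f \<in> C" for f
    using that unfolding C_eq
    by (rule span_coef_relation[where R = "\<lambda>c. c 2 = 0 \<and> c 3 = 0 \<and> c 4 = 0 \<and> c 6 = 0 \<and> c 7 = 0 \<and> c 1 = \<delta> * c 5"])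
      (simp, (auto simp: coef_linear coef_T_eq[OF n])[1], simp_all add: algebra_simps)
  have dim: "ldim C < n"
    using ldim_span_list[of "[T 0, lscale \<delta> (T 1) + T 5]"] by (simp add: n C_eq)
  have "h_val q n C \<le> 0"
  proof (rule h_val_le_card[OF _ C, where I = "\<lambda>_. {}"])
    fix j g i assume j: "j < n" "coprime j n" and g: "g \<in> C" "T j \<circ> g \<in> C" "g \<in> qpolys" "i < n"
    have "j = 1 \<or> j = 3 \<or> j = 5 \<or> j = 7" using j coprime_8_cases n by simp
    with rel[OF g(1)] rel[OF g(2)] nat_less_7_cases[of i] nat_less_8_cases[of i] g(3) g(4)[unfolded n] \<delta>
    show "coef g i = 0" by (auto simp: coef_T_comp_eq[OF n])
  qed (use n in simp_all)
  moreover have "1 \<le> gab_index q n C"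
    by (rule monomials_le_gab_index[OF C(1), where a = 0])
      (use n_pos in \<open>auto simp: C_eq ls.span_base\<close>)
  ultimately show ?thesis
    using gab_index_h_val_eqI[OF _ C(1) dim, of 0] n by simp
qed

lemma binomial_dual_code_6:
  fixes \<epsilon> :: 'a
  assumes n: "n = 6" and \<epsilon>: "\<epsilon> \<noteq> 0"
  defines "C \<equiv> lspan {T 1, T 2, T 4, \<lambda>x. T 0 x - \<epsilon> * T 3 x}"
  shows "gab_index q n C = 2 \<and> h_val q n C = 2"
proof -
  have n2: "2 \<le> n" using n by simp
  have "(\<lambda>x. T 0 x - \<epsilon> * T 3 x) = T 0 - lscale \<epsilon> (T 3)"
    by (simp add: fun_eq_iff)
  then have C_eq: "C = lspan {T 1, T 2, T 4, T 0 - lscale \<epsilon> (T 3)}"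
    unfolding C_def by (rule arg_cong)
  have C: "lsubspace C" "C \<subseteq> qpolys"
    unfolding C_eq by (rule ls.subspace_span, rule ls.span_minimal[OF _ subspace_qpolys]) simp
  have rel: "coef f 5 = 0 \<and> coef f 3 = - \<epsilon> * coef f 0"
    if "f \<in> C" for f
    using that unfolding C_eq
    by (rule span_coef_relation[where R = "\<lambda>c. c 5 = 0 \<and> c 3 = - \<epsilon> * c 0"])
      (simp, (auto simp: coef_linear coef_T_eq[OF n])[1], simp_all add: algebra_simps)
  have dim: "ldim C < n"
    using ldim_span_list[of "[T 1, T 2, T 4, T 0 - lscale \<epsilon> (T 3)]"] by (simp add: n C_eq)
  have base: "T 1 \<in> C" "T 2 \<in> C" "T 4 \<in> C" "T 0 - lscale \<epsilon> (T 3) \<in> C"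
    by (simp_all add: C_eq ls.span_base)
  \<comment> \<open>The test sets omit what is forced. For shift 1, index 4 moves to the empty 5 and
    index 2 to 3, tied to a coefficient coming from 5. For shift 5, index 0 moves to 5 and index 4
    to 3, tied to a coefficient coming from 1. Index 3 is tied to 0 throughout.\<close>
  have "h_val q n C \<le> 2"
  proof (rule h_val_le_card[OF _ C, where I = "\<lambda>j. if j = 1 then {0, 1} else {1, 2}"])
    fix j g i
    assume j: "j < n" "coprime j n" and g: "g \<in> C" "T j \<circ> g \<in> C" "g \<in> qpolys" "i < n"
      and I: "\<forall>i\<in>if j = 1 then {0, 1} else {1, 2}. coef g i = 0"
    have "j = 1 \<or> j = 5" using j coprime_6_cases n by simp
    with rel[OF g(1)] rel[OF g(2)] nat_less_7_cases[of i] g(3) g(4)[unfolded n] I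
    show "coef g i = 0" by (auto simp: coef_T_comp_eq[OF n])
  qed (use n in simp_all)
  moreover have "card {0, 1::nat} \<le> h_val q n C"
  proof (rule card_le_h_val[OF n2 C, where b = "\<lambda>i. if i = 0 then T 0 - lscale \<epsilon> (T 3) else T 1"])
    have "T 1 \<circ> (T 0 - lscale \<epsilon> (T 3)) = T 1 - lscale (T 1 \<epsilon>) (T 4)" "T 1 \<circ> T 1 = T 2"
      using T_add[of 1] by (simp_all add: fun_eq_iff T_diff T_mult numeral_eq_Suc)
    then show "T 1 \<circ> (if i = 0 then T 0 - lscale \<epsilon> (T 3) else T 1) \<in> C" for i :: nat
      using base by (simp add: ls.subspace_diff[OF C(1)] ls.subspace_scale[OF C(1)])
  qed (use base in \<open>auto simp: coef_linear coef_T_eq[OF n]\<close>)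
  \<comment> \<open>With three orbit members the empty index 5 kills three neighbouring coefficients
    of \<open>g\<close>, and the three copies of the tie between 0 and 3 kill the others.\<close>
  moreover have "gab_index q n C \<le> 2"
  proof (rule gab_index_le_if_no_orbit[OF _ C dim])
    fix g j i
    assume j: "1 \<le> j" "j < n" "coprime j n" and orbit: "\<And>i. i \<le> 2 \<Longrightarrow> T (j * i) \<circ> g \<in> C" and i: "i < n"
    have g: "g \<in> C" "T j \<circ> g \<in> C" "T (j * 2) \<circ> g \<in> C"
      using orbit[of 0] orbit[of 1] orbit[of 2] by (simp_all add: T_0)
    have "j = 1 \<or> j = 5" "g \<in> qpolys" using j coprime_6_cases n g(1) C(2) by auto
    with rel[OF g(1)] rel[OF g(2)] rel[OF g(3)] nat_less_7_cases[of i] i[unfolded n] \<epsilon>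
    show "coef g i = 0" by (auto simp: coef_T_comp_eq[OF n])
  qed (use n in simp)
  moreover have "2 \<le> gab_index q n C"
  proof (rule monomials_le_gab_index[OF C(1), where a = 1])
    fix i :: nat assume "i < 2"
    then have "i = 0 \<or> i = 1" by auto
    then show "T (1 + i) \<in> C" using base by (auto simp: numeral_eq_Suc)
  qed (simp add: n)
  ultimately show ?thesis by simp
qed

lemma binomial_dual_code_8:
  fixes \<delta> :: 'a
  assumes n: "n = 8" and \<delta>: "\<delta> \<noteq> 0"
  defines "C \<equiv> lspan {T 1, T 2, T 3, T 5, T 6, \<lambda>x. T 0 x - \<delta> * T 4 x}"
  shows "gab_index q n C = 3 \<and> h_val q n C = 4"
proof -
  have n2: "2 \<le> n" using n by simp
  have "(\<lambda>x. T 0 x - \<delta> * T 4 x) = T 0 - lscale \<delta> (T 4)"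
    by (simp add: fun_eq_iff)
  then have C_eq: "C = lspan {T 1, T 2, T 3, T 5, T 6, T 0 - lscale \<delta> (T 4)}"
    unfolding C_def by (rule arg_cong)
  have C: "lsubspace C" "C \<subseteq> qpolys"
    unfolding C_eq by (rule ls.subspace_span, rule ls.span_minimal[OF _ subspace_qpolys]) simp
  have rel: "coef f 7 = 0 \<and> coef f 4 = - \<delta> * coef f 0"
    if "f \<in> C" for f
    using that unfolding C_eq
    by (rule span_coef_relation[where R = "\<lambda>c. c 7 = 0 \<and> c 4 = - \<delta> * c 0"])
      (simp, (auto simp: coef_linear coef_T_eq[OF n])[1], simp_all add: algebra_simps)
  have dim: "ldim C < n"
    using ldim_span_list[of "[T 1, T 2, T 3, T 5, T 6, T 0 - lscale \<delta> (T 4)]"] by (simp add: n C_eq)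
  have base: "T 1 \<in> C" "T 2 \<in> C" "T 3 \<in> C" "T 5 \<in> C" "T 6 \<in> C" "T 0 - lscale \<delta> (T 4) \<in> C"
    by (simp_all add: C_eq ls.span_base)
  \<comment> \<open>For each odd shift four coefficients are forced by the others: through the empty
    index 7 of \<open>g\<close> and of its shift, and through the tie between 0 and 4 in both. The
    test set is the complement.\<close>
  have "h_val q n C \<le> 4"
  proof (rule h_val_le_card[OF _ C, where I = "\<lambda>j. if j = 1 then {0, 1, 2, 5}
      else if j = 3 then {2, 3, 5, 6} else if j = 5 then {0, 1, 5, 6} else {1, 2, 3, 6}"])
    fix j g i
    assume j: "j < n" "coprime j n" and g: "g \<in> C" "T j \<circ> g \<in> C" "g \<in> qpolys" "i < n"
      and I: "\<forall>i\<in>if j = 1 then {0, 1, 2, 5} else if j = 3 then {2, 3, 5, 6}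
        else if j = 5 then {0, 1, 5, 6} else {1, 2, 3, 6}. coef g i = 0"
    have "j = 1 \<or> j = 3 \<or> j = 5 \<or> j = 7" using j coprime_8_cases n by simp
    with rel[OF g(1)] rel[OF g(2)] nat_less_7_cases[of i] nat_less_8_cases[of i] g(3) g(4)[unfolded n] I \<delta>
    show "coef g i = 0" by (auto simp: coef_T_comp_eq[OF n])
  qed (use n in simp_all)
  \<comment> \<open>One step maps the binomial to a combination of \<open>T 1\<close> and
    \<open>T 5\<close>, and moves the indices 1, 2, 5 to 2, 3, 6.\<close>
  moreover have "card {0, 1, 2, 5::nat} \<le> h_val q n C"
  proof (rule card_le_h_val[OF n2 C, where b = "\<lambda>i. if i = 0 then T 0 - lscale \<delta> (T 4) else T i"])
    have "T 1 \<circ> (T 0 - lscale \<delta> (T 4)) = T 1 - lscale (T 1 \<delta>) (T 5)"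
      using T_add[of 1] by (simp add: fun_eq_iff T_diff T_mult numeral_eq_Suc)
    moreover have "T 1 \<circ> T 1 = T 2" "T 1 \<circ> T 2 = T 3" "T 1 \<circ> T 5 = T 6"
      unfolding T_comp by (simp_all add: numeral_eq_Suc)
    ultimately show "T 1 \<circ> (if i = 0 then T 0 - lscale \<delta> (T 4) else T i) \<in> C"
      if "i \<in> {0, 1, 2, 5}" for i :: nat
      using base that by (auto simp: ls.subspace_diff[OF C(1)] ls.subspace_scale[OF C(1)])
  qed (use base in \<open>auto simp: coef_linear coef_T_eq[OF n]\<close>)
  moreover have "gab_index q n C \<le> 3"
  proof (rule gab_index_le_if_no_orbit[OF _ C dim])
    fix g j i
    assume j: "1 \<le> j" "j < n" "coprime j n" and orbit: "\<And>i. i \<le> 3 \<Longrightarrow> T (j * i) \<circ> g \<in> C" and i: "i < n"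
    have g: "g \<in> C" "T j \<circ> g \<in> C" "T (j * 2) \<circ> g \<in> C" "T (j * 3) \<circ> g \<in> C"
      using orbit[of 0] orbit[of 1] orbit[of 2] orbit[of 3] by (simp_all add: T_0)
    have "j = 1 \<or> j = 3 \<or> j = 5 \<or> j = 7" "g \<in> qpolys" using j coprime_8_cases n g(1) C(2) by auto
    with rel[OF g(1)] rel[OF g(2)] rel[OF g(3)] rel[OF g(4)]
      nat_less_7_cases[of i] nat_less_8_cases[of i] i[unfolded n] \<delta>
    show "coef g i = 0" by (auto simp: coef_T_comp_eq[OF n])
  qed (use n in simp)
  moreover have "3 \<le> gab_index q n C"
  proof (rule monomials_le_gab_index[OF C(1), where a = 1])
    fix i :: nat assume "i < 3"
    then have "i = 0 \<or> i = 1 \<or> i = 2" by auto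
    then show "T (1 + i) \<in> C" using base by (auto simp: numeral_eq_Suc)
  qed (simp add: n)
  ultimately show ?thesis by simp
qed

lemma T_Fq: "c \<in> Fq q \<Longrightarrow> T i c = c"
  by (simp add: T_def frob_Fq)

lemma trinomial_dual_code_6:
  fixes \<delta> :: 'a
  assumes n: "n = 6" and \<delta>: "\<delta> \<in> Fq q" "\<delta> \<noteq> 1" "\<delta> ^ 3 \<noteq> 1"
  defines "C \<equiv> lspan {T 1, T 3, \<lambda>x. T 0 x - T 2 x, \<lambda>x. T 4 x - \<delta> * T 0 x}"
  shows "gab_index q n C = 2 \<and> h_val q n C = 2"
proof -
  have n2: "2 \<le> n" using n by simp
  have eq: "(\<lambda>x. T 0 x - T 2 x) = T 0 - T 2" "(\<lambda>x. T 4 x - \<delta> * T 0 x) = T 4 - lscale \<delta> (T 0)"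
    by (simp_all add: fun_eq_iff)
  have C_eq: "C = lspan {T 1, T 3, T 0 - T 2, T 4 - lscale \<delta> (T 0)}"
    unfolding C_def eq by (rule refl)
  have C: "lsubspace C" "C \<subseteq> qpolys"
    unfolding C_eq by (rule ls.subspace_span, rule ls.span_minimal[OF _ subspace_qpolys]) simp
  have rel: "coef f 5 = 0 \<and> coef f 0 = - coef f 2 - \<delta> * coef f 4"
    if "f \<in> C" for f
    using that unfolding C_eq
    by (rule span_coef_relation[where R = "\<lambda>c. c 5 = 0 \<and> c 0 = - c 2 - \<delta> * c 4"])
      (simp, (auto simp: coef_linear coef_T_eq[OF n])[1], simp, simp, simp add: algebra_simps)
  \<comment> \<open>Since \<delta> is fixed by Frobenius and \<open>T j\<close> is injective, the
    relation for the shifted map pulls back to an untwisted linear relation among the coefficients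
    of \<open>g\<close>.\<close>
  have rel_T: "coef (T j \<circ> g) 5 = 0 \<and> coef g ((6 - j mod 6) mod 6)
      = - coef g ((2 + (6 - j mod 6)) mod 6) - \<delta> * coef g ((4 + (6 - j mod 6)) mod 6)"
    if "T j \<circ> g \<in> C" "g \<in> qpolys" for g j
  proof -
    have "T j (coef g ((6 - j mod 6) mod 6))
      = T j (- coef g ((2 + (6 - j mod 6)) mod 6) - \<delta> * coef g ((4 + (6 - j mod 6)) mod 6))"
      using rel[OF that(1)] that(2) by (simp add: coef_T_comp_eq[OF n] T_uminus T_diff T_mult T_Fq \<delta>(1))
    then show ?thesis
      using rel[OF that(1)] unfolding T_def by (simp add: injD[OF bij_is_inj[OF bij_frob]])
  qed
  have dim: "ldim C < n"
    using ldim_span_list[of "[T 1, T 3, T 0 - T 2, T 4 - lscale \<delta> (T 0)]"] by (simp add: n C_eq)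
  have base: "T 1 \<in> C" "T 3 \<in> C" "T 0 - T 2 \<in> C" "T 4 - lscale \<delta> (T 0) \<in> C"
    by (simp_all add: C_eq ls.span_base)
  \<comment> \<open>Eliminating \<open>T 0\<close> from the two binomials gives a map that is the
    shift of \<open>T 3 - lscale \<delta> (T 1)\<close>, itself in the code. This pair is the orbit
    of length 2 used below.\<close>
  have "(T 4 - lscale \<delta> (T 0)) + lscale \<delta> (T 0 - T 2) \<in> C"
    by (intro ls.subspace_add[OF C(1)] ls.subspace_scale[OF C(1)] base)
  also have "(T 4 - lscale \<delta> (T 0)) + lscale \<delta> (T 0 - T 2) = T 4 - lscale \<delta> (T 2)"
    by (simp add: fun_eq_iff algebra_simps)
  finally have T42: "T 4 - lscale \<delta> (T 2) \<in> C" .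
  have T_comp_diff: "T 1 \<circ> (T 3 - lscale \<delta> (T 1)) = T 4 - lscale \<delta> (T 2)"
    using T_add[of 1] by (simp add: fun_eq_iff T_diff T_mult T_Fq \<delta>(1) numeral_eq_Suc)
  have "h_val q n C \<le> 2"
  proof (rule h_val_le_card[OF _ C, where I = "\<lambda>j. if j = 1 then {2, 3} else {3, 4}"])
    fix j g i
    assume j: "j < n" "coprime j n" and g: "g \<in> C" "T j \<circ> g \<in> C" "g \<in> qpolys" "i < n"
      and I: "\<forall>i\<in>if j = 1 then {2, 3} else {3, 4}. coef g i = 0"
    have "j = 1 \<or> j = 5" using j coprime_6_cases n by simp
    with rel[OF g(1)] rel_T[OF g(2,3)] nat_less_7_cases[of i] g(3) g(4)[unfolded n] I
    show "coef g i = 0" by (auto simp: coef_T_comp_eq[OF n])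
  qed (use n in simp_all)
  moreover have "card {0, 3::nat} \<le> h_val q n C"
  proof (rule card_le_h_val[OF n2 C, where b = "\<lambda>i. if i = 0 then T 0 - T 2 else T 3 - lscale \<delta> (T 1)"])
    have "T 1 \<circ> (T 0 - T 2) = T 1 - T 3"
      using T_add[of 1] by (simp add: fun_eq_iff T_diff numeral_eq_Suc)
    then show "T 1 \<circ> (if i = 0 then T 0 - T 2 else T 3 - lscale \<delta> (T 1)) \<in> C" for i :: nat
      using base T42 by (simp add: T_comp_diff ls.subspace_diff[OF C(1)] del: One_nat_def)
  qed (use base in \<open>auto simp: coef_linear coef_T_eq[OF n] ls.subspace_diff[OF C(1)] ls.subspace_scale[OF C(1)]\<close>)
  moreover have "gab_index q n C \<le> 2"
  proof (rule gab_index_le_if_no_orbit[OF _ C dim])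
    fix g j i
    assume j: "1 \<le> j" "j < n" "coprime j n" and orbit: "\<And>i. i \<le> 2 \<Longrightarrow> T (j * i) \<circ> g \<in> C" and i: "i < n"
    have g: "g \<in> C" "T j \<circ> g \<in> C" "T (j * 2) \<circ> g \<in> C"
      using orbit[of 0] orbit[of 1] orbit[of 2] by (simp_all add: T_0)
    \<comment> \<open>The empty index leaves two coefficients, and the two remaining relations
      combine to \<open>x = \<delta> * x\<close> for one of them.\<close>
    have fixpoint: "x = \<delta> * x \<longleftrightarrow> x = 0" for x :: 'a using \<delta>(2) by auto
    have "j = 1 \<or> j = 5" "g \<in> qpolys" using j coprime_6_cases n g(1) C(2) by auto
    with rel[OF g(1)] rel_T[OF g(2)] rel_T[OF g(3)] nat_less_7_cases[of i] i[unfolded n] \<delta>(2)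
    show "coef g i = 0" by (auto simp: coef_T_comp_eq[OF n] fixpoint)
  qed (use n in simp)
  moreover have "2 \<le> gab_index q n C"
  proof (rule gab_index_ge[OF C(1), where g = "T 3 - lscale \<delta> (T 1)"])
    have lin: "fq_linear q (T i)" for i unfolding T_def by (rule fq_linear_frob)
    show "fq_linear q (T 3 - lscale \<delta> (T 1))"
      using lin[of 3] lin[of 1] by (auto simp: fq_linear_def algebra_simps)
    have "x = y" if "(T 3 - lscale \<delta> (T 1)) x = (T 3 - lscale \<delta> (T 1)) y" for x y
    proof -
      define z where "z = T 1 (x - y)"
      have "T 3 (x - y) = \<delta> * T 1 (x - y)"
        using that by (simp add: T_diff algebra_simps)
      \<comment> \<open>A kernel element would be an eigenvector of \<open>T 2\<close>; applying
        \<open>T 2\<close> three times is the identity, so its eigenvalue would have cube 1.\<close>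
      then have z: "T 2 z = \<delta> * z"
        unfolding z_def T_add[symmetric] by (simp add: numeral_eq_Suc)
      have "T 6 z = T 2 (T 2 (T 2 z))" unfolding T_add[symmetric] by simp
      also have "\<dots> = \<delta> ^ 3 * z" by (simp add: z T_mult T_Fq \<delta>(1) power3_eq_cube)
      also have "T 6 z = z" using T_mod[of 6] by (simp add: n T_0)
      finally have "z = 0" using \<delta>(3) by simp
      then show ?thesis by (simp add: z_def)
    qed
    then have inj: "inj (T 3 - lscale \<delta> (T 1))" by (rule injI)
    show "bij (T 3 - lscale \<delta> (T 1))"
      using inj finite_UNIV_inj_surj[OF finite inj] by (rule bijI)
    fix i :: nat assume "i < 2"
    then have "i = 0 \<or> i = 1" by auto
    then show "T i \<circ> (T 3 - lscale \<delta> (T 1)) \<in> C"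
      using T42 T_comp_diff base
      by (auto simp: T_0 ls.subspace_diff[OF C(1)] ls.subspace_scale[OF C(1)] simp del: One_nat_def)
  qed (simp add: n)
  ultimately show ?thesis by simp
qed

subsection \<open>Twisted Gabidulin codes\<close>

text \<open>The monomials with indices 1 to k - 1 form the long orbit. For the bound on h, two of
  the k free coefficients must be shown redundant for each coprime shift; which two depends on where
  the shift cuts the cyclic index range.\<close>

lemma twisted_gab:
  fixes \<eta> :: 'a
  assumes k: "1 < k" "k < n - 1" and \<eta>: "\<eta> \<noteq> 0"
  defines "C \<equiv> lspan ({\<lambda>x. x + \<eta> * T k x} \<union> T ` {1..<k})"
  shows "gab_index q n C = k - 1 \<and> h_val q n C = k - 2"
proof -
  have "(\<lambda>x. x + \<eta> * T k x) = T 0 + lscale \<eta> (T k)"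
    by (simp add: fun_eq_iff T_0)
  then have C_eq: "C = lspan ({T 0 + lscale \<eta> (T k)} \<union> T ` {1..<k})"
    unfolding C_def by (rule arg_cong)
  have C: "lsubspace C" "C \<subseteq> qpolys"
    unfolding C_eq by (rule ls.subspace_span, rule ls.span_minimal[OF _ subspace_qpolys]) auto
  have n2: "2 \<le> n" and small: "i \<le> k \<Longrightarrow> i mod n = i" for i using k by simp_all
  have rel: "(\<forall>i. k < i \<and> i < n \<longrightarrow> coef f i = 0) \<and> coef f k = \<eta> * coef f 0"
    if "f \<in> C" for f
    using that unfolding C_eq
    by (rule span_coef_relation[where R = "\<lambda>c. (\<forall>i. k < i \<and> i < n \<longrightarrow> c i = 0) \<and> c k = \<eta> * c 0"])
      ((use k in \<open>auto simp: coef_linear coef_T small\<close>)[2], simp_all add: algebra_simps)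
  have dim: "ldim C < n"
  proof -
    have "ldim C \<le> card ({T 0 + lscale \<eta> (T k)} \<union> T ` {1..<k})"
      unfolding C_eq by (rule ls.dim_le_card) auto
    also have "\<dots> \<le> 1 + card {1..<k}"
      using card_Un_le[of "{T 0 + lscale \<eta> (T k)}"] card_image_le[of "{1..<k}" T]
      by (metis (no_types, lifting) add_left_mono card_1_singleton_iff finite_atLeastLessThan is_singletonI is_singleton_altdef order_trans)
    finally show ?thesis using k by simp
  qed
  \<comment> \<open>The pair left out of \<open>{..<k}\<close> is 0, 1 if \<open>n - j\<close> is 1;
    the two indices just below \<open>n - j\<close> if that is at most \<open>k\<close>; and 0, k -
    1 otherwise.\<close>
  define I where "I j = (if n - j \<le> 1 then {2..<k} else if n - j \<le> k then {..<k} - {n - j - 1, n - j - 2}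
    else {1..<k - 1})" for j
  have "h_val q n C \<le> k - 2"
  proof (rule h_val_le_card[OF n2 C])
    show "finite (I j)" for j by (simp add: I_def)
    show "card (I j) \<le> k - 2" for j
    proof (cases "1 < n - j \<and> n - j \<le> k")
      case True
      then have "n - j - 1 \<noteq> n - j - 2" by linarith
      then have "card {n - j - 1, n - j - 2} = 2" by (metis card_2_iff)
      moreover have "{n - j - 1, n - j - 2} \<subseteq> {..<k}" using True by auto
      ultimately have "card ({..<k} - {n - j - 1, n - j - 2}) = k - 2"
        by (simp only: card_Diff_subset finite.intros card_lessThan)
      with True show ?thesis by (simp only: I_def not_le[symmetric] if_False if_True)
    qed (auto simp: I_def)
    fix j g i
    assume j: "1 \<le> j" "j < n" "coprime j n" and g: "g \<in> C" "T j \<circ> g \<in> C" "g \<in> qpolys"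
      and I: "\<forall>i\<in>I j. coef g i = 0" and i: "i < n"
    define m where "m = n - j"
    have m: "1 \<le> m" "m < n" using j by (auto simp: m_def)
    note rel_g = rel[OF g(1)]
    have zero: "coef g i = 0" if "k < (i + j) mod n" for i
    proof -
      have "coef (T j \<circ> g) ((i + j) mod n) = 0"
        using rel[OF g(2)] that n_pos by simp
      then show ?thesis
        using coef_T_comp[OF g(3), of j i] by (simp add: coef_mod)
    qed
    \<comment> \<open>The shift sends indices \<open>k + m\<close> and \<open>m\<close> to
      \<open>k\<close> and 0, where the shifted map obeys the twisted relation.\<close>
    have tie: "coef g (k + m) = 0 \<longleftrightarrow> coef g m = 0"
    proof -
      have "coef (T j \<circ> g) (k + n) = T j (coef g (k + m))" "coef (T j \<circ> g) n = T j (coef g m)"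
        using coef_T_comp[OF g(3), of j "k + m"] coef_T_comp[OF g(3), of j m] j by (simp_all add: m_def)
      moreover have "coef (T j \<circ> g) (k + n) = coef (T j \<circ> g) k" "coef (T j \<circ> g) n = coef (T j \<circ> g) 0"
        by (rule coef_cong; simp add: cong_def)+
      ultimately have "T j (coef g (k + m)) = \<eta> * T j (coef g m)"
        using rel[OF g(2)] by simp
      with \<eta> show ?thesis by (metis T_eq_0_iff mult_eq_0_iff)
    qed
    have low: "coef g i = 0" if "i < k" for i
    proof -
      consider "m = 1" | "2 \<le> m" "m \<le> k" | "k < m" using m by linarith
      then show ?thesis
      proof cases
        case 1
        then have "coef g 0 = 0" using zero[of 0] k by (simp add: m_def)
        moreover have "coef g 1 = 0" using tie k rel_g 1 by simp
        ultimately show ?thesis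
          using I that 1 by (cases "i = 0 \<or> i = 1") (auto simp: I_def m_def)
      next
        case 2
        have "coef g (m - 1) = 0" using zero[of "m - 1"] 2 k j by (simp add: m_def)
        moreover have "coef g (m - 2) = 0"
        proof (cases "k = n - 2")
          case False
          then show ?thesis using zero[of "m - 2"] 2 k j by (simp add: m_def)
        next
          \<comment> \<open>For \<open>k = n - 2\<close> the index \<open>m - 2\<close> moves to
            \<open>k\<close>, which is not empty, so the tie has to be used instead; it needs
            coefficient \<open>m\<close> to vanish.\<close>
          case True
          have "coef g m = 0"
          proof (cases "m = k")
            case False
            then show ?thesis using I 2 by (auto simp: I_def m_def)
          next
            case m_eq: True
            \<comment> \<open>If \<open>m = k = 2\<close>, index 0 would be missing from the test
              set; this forces \<open>n = 4\<close> and \<open>j = 2\<close>, which are not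
              coprime.\<close>
            have "k \<noteq> 2"
            proof
              assume "k = 2"
              with True m_eq k have "n = 4" "j = 2" by (simp_all add: m_def)
              with j(3) show False by simp
            qed
            then have "coef g 0 = 0" using I 2 m_eq k by (auto simp: I_def m_def)
            then show ?thesis using rel_g m_eq by simp
          qed
          then have "coef g (k + m) = 0" using tie by simp
          moreover have "[k + m = m - 2] (mod n)"
            using True 2 k by (simp add: cong_def mod_if)
          ultimately show ?thesis using coef_cong by metis
        qed
        ultimately show ?thesis
          using I that 2 by (cases "i = m - 1 \<or> i = m - 2") (auto simp: I_def m_def)
      next
        case 3
        have "coef g k = 0" using zero[of k] 3 m j k by (simp add: m_def)
        then have "coef g 0 = 0" using rel_g \<eta> by simp
        moreover have "coef g (k - 1) = 0"
        proof (cases "m = n - 1")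
          case False
          then show ?thesis using zero[of "k - 1"] 3 m j k by (simp add: m_def)
        next
          case True
          have "coef g m = 0" using rel_g 3 m by simp
          then have "coef g (k + m) = 0" using tie by simp
          moreover have "[k + m = k - 1] (mod n)"
            using True k by (simp add: cong_def mod_if)
          ultimately show ?thesis using coef_cong by metis
        qed
        ultimately show ?thesis
          using I that 3 k by (cases "i = 0 \<or> i = k - 1") (auto simp: I_def m_def)
      qed
    qed
    consider "i < k" | "i = k" | "k < i" by linarith
    then show "coef g i = 0"
      using low rel_g k i by cases auto
  qed
  moreover have "k - 1 \<le> gab_index q n C"
    by (rule monomials_le_gab_index[OF C(1), where a = 1])
      (use k in \<open>auto simp: C_eq ls.span_base\<close>)
  ultimately show ?thesis
    using gab_index_h_val_eqI[OF n2 C(1) dim, of "k - 2"] k by (simp add: Suc_diff_Suc numeral_eq_Suc)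
qed

end

section \<open>The rank of x - x^[4] and the MRD condition in degree 6\<close>

context frob_field
begin

text \<open>Values y = x - x^[4] satisfy y + y^[2] + y^[4] = 0 by telescoping modulo 6, which bounds
  the range above. An x fixed by the fourth power is fixed by the eighth, that is the second, so
  fibres have at most \<open>q ^ 2\<close> elements and the range at least
  \<open>q ^ 4\<close>.\<close>

lemma card_range_frob_diff_6:
  assumes n: "n = 6"
  shows "card (range (\<lambda>x::'a. x - frob q 4 x)) = q ^ 4"
proof -
  let ?f = "\<lambda>x::'a. x - frob q 4 x"
  have f_diff: "?f (x - y) = ?f x - ?f y" for x y
    by (simp add: frob_diff)
  have frob_6: "frob q (6 + i) x = frob q i (x::'a)" for i x
    using frob_mod[of "6 + i"] frob_mod[of i] by (simp add: n)
  have "range ?f \<subseteq> {x. (\<Sum>i\<in>{0, 2, 4}. 1 * frob q i x) = 0}"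
    using frob_6[of 0] frob_6[of 2] by (auto simp: frob_diff frob_frob)
  then have le: "card (range ?f) \<le> q ^ 4"
    using card_mono[OF _ \<open>range ?f \<subseteq> _\<close>] card_frob_roots_le[of "{0, 2, 4}" 4 "\<lambda>_. 1"] by fastforce
  have "{x. ?f x = 0} \<subseteq> {x. (\<Sum>i\<in>{0, 2}. (if i = 0 then - 1 else 1) * frob q i x) = 0}"
  proof safe
    fix x assume "?f x = 0"
    then have x: "frob q 4 x = x" by simp
    have "frob q 2 x = frob q 4 (frob q 4 x)" using frob_6[of 2 x] by (simp add: frob_frob)
    then show "(\<Sum>i\<in>{0, 2}. (if i = 0 then - 1 else 1) * frob q i x) = 0" by (simp add: x)
  qed
  then have "card {x. ?f x = 0} \<le> q ^ 2"
    using card_mono[OF _ \<open>{x. ?f x = 0} \<subseteq> _\<close>]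
      card_frob_roots_le[of "{0, 2}" 2 "\<lambda>i. if i = 0 then - 1 else 1"] by fastforce
  moreover have "card {x. ?f x = y} \<le> card {x. ?f x = 0}" if y: "y \<in> range ?f" for y
  proof -
    obtain z where "y = ?f z" using y by blast
    then have "?f (x - z) = 0" if "?f x = y" for x
      using that f_diff[of x z] by (simp only: diff_self)
    then show ?thesis
      by (intro card_inj_on_le[of "\<lambda>x. x - z"]) (auto intro!: inj_onI)
  qed
  ultimately have fibre: "card {x. ?f x = y} \<le> q ^ 2" if "y \<in> range ?f" for y
    using that order_trans by blast
  have "q ^ 6 = (\<Sum>y\<in>range ?f. card {x. ?f x = y})"
    using sum.image_gen[of "UNIV :: 'a set" "\<lambda>_. 1::nat" ?f] by (simp flip: n card_F)
  also have "\<dots> \<le> card (range ?f) * q ^ 2"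
    using sum_bounded_above[of "range ?f", OF fibre] by simp
  finally have "q ^ 4 * q ^ 2 \<le> card (range ?f) * q ^ 2"
    by (simp flip: power_add)
  moreover have "0 < q ^ 2" using q_gt_1 by simp
  ultimately have "q ^ 4 \<le> card (range ?f)" by (simp only: mult_le_cancel2)
  with le show ?thesis by simp
qed

text \<open>
  For \<open>\<delta> = 0\<close> the code contains \<open>x - x\<^bsup>[4]\<^esup>\<close>, of rank 4, whereas an MRD code of this size has
  minimum distance 5.
\<close>

lemma MRD_binomial_code_6_imp:
  assumes n: "n = 6" and MRD: "MRD q n (lspan {frob q 0, \<lambda>x::'a. \<delta> * frob q 1 x + frob q 4 x})"
  shows "\<delta> \<noteq> 0"
proof
  assume "\<delta> = 0"
  interpret one: galois_gen q n F 1 by unfold_locales simp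
  define C :: "('a \<Rightarrow> 'a) set" where "C = lspan (one.T ` {0, 4})"
  have "MRD q n C"
    using MRD by (simp add: C_def \<open>\<delta> = 0\<close> one.T_def del: One_nat_def)
  moreover have "ldim C = 2"
    unfolding C_def by (subst one.ldim_span_monomials) (auto simp: n)
  then have "card C = q ^ 12"
    using card_lsubspace[of C] by (simp add: C_def ls.subspace_span card_F n flip: power_mult)
  ultimately have "q ^ 12 = q ^ (6 * (6 - min_dist q C + 1))"
    by (simp add: MRD_def n)
  then have "12 = 6 * (6 - min_dist q C + 1)"
    using q_gt_1 power_inject_exp by blast
  then have "min_dist q C = 5" by simp
  moreover have "min_dist q C \<le> 4"
  proof -
    let ?f = "one.T 0 - one.T 4"
    have eq: "?f = (\<lambda>x. x - frob q 4 x)" by (simp add: fun_eq_iff one.T_def del: One_nat_def)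
    have card: "card (range ?f) = q ^ 4"
      unfolding eq by (rule card_range_frob_diff_6[OF n])
    have "rk q ?f = 4"
      unfolding rk_def card using q_gt_1 by (intro the_equality) auto
    moreover have "?f \<noteq> 0"
    proof
      assume "?f = 0"
      then have "range ?f = {0}" by auto
      with card have "q ^ 4 = 1" by simp
      with q_gt_1 show False by simp
    qed
    moreover have "?f \<in> C"
      unfolding C_def by (intro ls.span_diff ls.span_base) auto
    ultimately show ?thesis
      unfolding min_dist_def by (intro Min_le) (auto simp: setcompr_eq_image intro!: exI[of _ ?f])
  qed
  ultimately show False by simp
qed

end

section \<open>The twelve families of codes\<close>

theorem theorem4p2:
  fixes q n :: nat and F :: "'a::{field,finite} itself"
  assumes q: "primepow q"
    and card: "card (UNIV :: 'a set) = q ^ n"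
  shows
  "(\<forall>k s. coprime s n \<and> 1 \<le> k \<and> k < n \<longrightarrow>
      gab_index q n (gab q k s :: ('a \<Rightarrow> 'a) set) = k \<and> h_val q n (gab q k s :: ('a \<Rightarrow> 'a) set) = k - 1)
 \<and> (\<forall>k s (\<eta>::'a). coprime s n \<and> 1 < k \<and> k < n - 1 \<and> \<eta> \<noteq> 0 \<and> normq q n \<eta> \<noteq> (-1) ^ (n * k) \<longrightarrow>
      (let C = lspan ({(\<lambda>x. x + \<eta> * frob q (s * k) x)} \<union> {frob q (s * i) | i. 1 \<le> i \<and> i < k})
       in gab_index q n C = k - 1 \<and> h_val q n C = k - 2))
 \<and> (\<forall>\<delta>::'a. n = 6 \<and> q > 4 \<and> MRD q n (lspan {frob q 0, (\<lambda>x. \<delta> * frob q 1 x + frob q 4 x)}) \<longrightarrow>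
      (let C = lspan {frob q 0, (\<lambda>x. \<delta> * frob q 1 x + frob q 4 x)}
       in gab_index q n C = 1 \<and> h_val q n C = 0))
 \<and> (\<forall>\<delta>::'a. n = 6 \<and> odd q \<and> q mod 5 \<in> {0, 1, 4} \<and> \<delta> \<in> Fq q \<and> \<delta>\<^sup>2 + \<delta> = 1 \<longrightarrow>
      (let C = lspan {frob q 0, (\<lambda>x. frob q 1 x + frob q 3 x + \<delta> * frob q 5 x)}
       in gab_index q n C = 1 \<and> h_val q n C = 0))
 \<and> (\<forall>s. n = 7 \<and> odd q \<and> coprime s 7 \<longrightarrow>
      (let C = (lspan {frob q 0, frob q s, frob q (3 * s)} :: ('a \<Rightarrow> 'a) set)
       in gab_index q n C = 2 \<and> h_val q n C = 1))
 \<and> (\<forall>\<delta>::'a. n = 8 \<and> odd q \<and> \<delta>\<^sup>2 = -1 \<longrightarrow>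
      (let C = lspan {frob q 0, (\<lambda>x. \<delta> * frob q 1 x + frob q 5 x)}
       in gab_index q n C = 1 \<and> h_val q n C = 0))
 \<and> (\<forall>s. n = 8 \<and> q mod 3 = 1 \<and> coprime s 8 \<longrightarrow>
      (let C = (lspan {frob q 0, frob q s, frob q (3 * s)} :: ('a \<Rightarrow> 'a) set)
       in gab_index q n C = 2 \<and> h_val q n C = 1))
 \<and> (\<forall>\<delta>::'a. n = 6 \<and> q > 4 \<and> MRD q n (lspan {frob q 0, (\<lambda>x. \<delta> * frob q 1 x + frob q 4 x)}) \<longrightarrow>
      (let C = lspan {frob q 1, frob q 2, frob q 4, (\<lambda>x. frob q 0 x - \<delta> ^ (q ^ 5) * frob q 3 x)}
       in gab_index q n C = 2 \<and> h_val q n C = 2))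
 \<and> (\<forall>\<delta>::'a. n = 6 \<and> odd q \<and> q mod 5 \<in> {0, 1, 4} \<and> \<delta> \<in> Fq q \<and> \<delta>\<^sup>2 + \<delta> = 1 \<longrightarrow>
      (let C = lspan {frob q 1, frob q 3, (\<lambda>x. frob q 0 x - frob q 2 x), (\<lambda>x. frob q 4 x - \<delta> * frob q 0 x)}
       in gab_index q n C = 2 \<and> h_val q n C = 2))
 \<and> (\<forall>s. n = 7 \<and> odd q \<and> coprime s 7 \<longrightarrow>
      (let C = (lspan {frob q 0, frob q (2 * s), frob q (3 * s), frob q (4 * s)} :: ('a \<Rightarrow> 'a) set)
       in gab_index q n C = 3 \<and> h_val q n C = 2))
 \<and> (\<forall>\<delta>::'a. n = 8 \<and> odd q \<and> \<delta>\<^sup>2 = -1 \<longrightarrow>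
      (let C = lspan {frob q 1, frob q 2, frob q 3, frob q 5, frob q 6, (\<lambda>x. frob q 0 x - \<delta> * frob q 4 x)}
       in gab_index q n C = 3 \<and> h_val q n C = 4))
 \<and> (\<forall>s. n = 8 \<and> q mod 3 = 1 \<and> coprime s 8 \<longrightarrow>
      (let C = (lspan {frob q 0, frob q (2 * s), frob q (3 * s), frob q (4 * s), frob q (5 * s)} :: ('a \<Rightarrow> 'a) set)
       in gab_index q n C = 4 \<and> h_val q n C = 3))"
proof -
  interpret frob_field q n F by unfold_locales (rule q, rule card)
  interpret one: galois_gen q n F 1 by unfold_locales simp
  note one_unfold = one.T_def mult_1
  have a: "gab_index q n (gab q k s :: ('a \<Rightarrow> 'a) set) = k \<and> h_val q n (gab q k s :: ('a \<Rightarrow> 'a) set) = k - 1"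
    if "coprime s n" "1 \<le> k" "k < n" for k s
  proof -
    interpret galois_gen q n F s by unfold_locales (rule that)
    show ?thesis
      using gab_index_h_val_gab[OF that(2,3)] that(3) by (simp add: gab_eq)
  qed
  have b: "let C = lspan ({(\<lambda>x. x + \<eta> * frob q (s * k) x)} \<union> {frob q (s * i) | i. 1 \<le> i \<and> i < k})
       in gab_index q n C = k - 1 \<and> h_val q n C = k - 2"
    if "coprime s n" "1 < k" "k < n - 1" "\<eta> \<noteq> 0" for k s and \<eta> :: 'a
  proof -
    interpret galois_gen q n F s by unfold_locales (rule that)
    have "T ` {1..<k} = {frob q (s * i) | i. 1 \<le> i \<and> i < k}"
      by (auto simp: T_def)
    with twisted_gab[OF that(2-4)] show ?thesis
      by (simp add: T_def Let_def)
  qed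
  have trinomial_cond: "\<delta> \<noteq> 1 \<and> \<delta> ^ 3 \<noteq> 1" if "odd q" "\<delta>\<^sup>2 + \<delta> = 1" for \<delta> :: 'a
  proof -
    have "\<delta> \<noteq> 1"
    proof
      assume "\<delta> = 1"
      then have "(2 :: 'a) - 1 = 1 - 1" using that(2) by simp
      then show False by simp
    qed
    \<comment> \<open>The equation for \<delta> reduces \<delta>^3 to 2\<delta> - 1; with 2 \<noteq>
      0 the cube is 1 only for \<delta> = 1.\<close>
    moreover have "2 * (\<delta> - 1) = \<delta> ^ 3 - 1"
      using that(2) by algebra
    ultimately show ?thesis using two_neq_zero_if_odd[OF that(1)] by auto
  qed
  have c: "let C = lspan {frob q 0, (\<lambda>x. \<delta> * frob q 1 x + frob q 4 x)}
      in gab_index q n C = 1 \<and> h_val q n C = 0" if "n = 6" for \<delta> :: 'a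
    using one.binomial_code_6[OF that, of \<delta>] unfolding one_unfold Let_def .
  have d: "let C = lspan {frob q 0, (\<lambda>x. frob q 1 x + frob q 3 x + \<delta> * frob q 5 x)}
      in gab_index q n C = 1 \<and> h_val q n C = 0" if "n = 6" for \<delta> :: 'a
    using one.trinomial_code_6[OF that, of \<delta>] unfolding one_unfold Let_def .
  have f: "let C = lspan {frob q 0, (\<lambda>x. \<delta> * frob q 1 x + frob q 5 x)}
      in gab_index q n C = 1 \<and> h_val q n C = 0" if "n = 8" "\<delta>\<^sup>2 = -1" for \<delta> :: 'a
  proof -
    have "\<delta> \<noteq> 0" using that(2) by auto
    then show ?thesis
      using one.binomial_code_8[OF that(1)] unfolding one_unfold Let_def by blast
  qed
  have h: "let C = lspan {frob q 1, frob q 2, frob q 4, (\<lambda>x. frob q 0 x - \<delta> ^ (q ^ 5) * frob q 3 x)}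
      in gab_index q n C = 2 \<and> h_val q n C = 2"
    if "n = 6" "MRD q n (lspan {frob q 0, (\<lambda>x. \<delta> * frob q 1 x + frob q 4 x)})" for \<delta> :: 'a
  proof -
    have "\<delta> ^ (q ^ 5) \<noteq> 0" using MRD_binomial_code_6_imp[OF that] by simp
    then show ?thesis
      using one.binomial_dual_code_6[OF that(1)] unfolding one_unfold Let_def by blast
  qed
  have i: "let C = lspan {frob q 1, frob q 3, (\<lambda>x. frob q 0 x - frob q 2 x), (\<lambda>x. frob q 4 x - \<delta> * frob q 0 x)}
      in gab_index q n C = 2 \<and> h_val q n C = 2"
    if "n = 6" "odd q" "\<delta> \<in> Fq q" "\<delta>\<^sup>2 + \<delta> = 1" for \<delta> :: 'a
    using one.trinomial_dual_code_6[OF that(1,3)] trinomial_cond[OF that(2,4)]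
    unfolding one_unfold Let_def by blast
  have k: "let C = lspan {frob q 1, frob q 2, frob q 3, frob q 5, frob q 6, (\<lambda>x. frob q 0 x - \<delta> * frob q 4 x)}
      in gab_index q n C = 3 \<and> h_val q n C = 4" if "n = 8" "\<delta>\<^sup>2 = -1" for \<delta> :: 'a
  proof -
    have "\<delta> \<noteq> 0" using that(2) by auto
    then show ?thesis
      using one.binomial_dual_code_8[OF that(1)] unfolding one_unfold Let_def by blast
  qed
  have ej: "let C = (lspan {frob q 0, frob q s, frob q (3 * s)} :: ('a \<Rightarrow> 'a) set)
      in gab_index q n C = 2 \<and> h_val q n C = 1"
    "let C = (lspan {frob q 0, frob q (2 * s), frob q (3 * s), frob q (4 * s)} :: ('a \<Rightarrow> 'a) set)
      in gab_index q n C = 3 \<and> h_val q n C = 2" if "n = 7" "coprime s 7" for s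
  proof -
    interpret galois_gen q n F s by unfold_locales (simp add: that)
    show "let C = (lspan {frob q 0, frob q s, frob q (3 * s)} :: ('a \<Rightarrow> 'a) set)
      in gab_index q n C = 2 \<and> h_val q n C = 1"
      "let C = (lspan {frob q 0, frob q (2 * s), frob q (3 * s), frob q (4 * s)} :: ('a \<Rightarrow> 'a) set)
      in gab_index q n C = 3 \<and> h_val q n C = 2"
      using monomials_7[OF that(1)] by (simp_all add: T_def mult.commute Let_def)
  qed
  have gl: "let C = (lspan {frob q 0, frob q s, frob q (3 * s)} :: ('a \<Rightarrow> 'a) set)
      in gab_index q n C = 2 \<and> h_val q n C = 1"
    "let C = (lspan {frob q 0, frob q (2 * s), frob q (3 * s), frob q (4 * s), frob q (5 * s)} :: ('a \<Rightarrow> 'a) set)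
      in gab_index q n C = 4 \<and> h_val q n C = 3" if "n = 8" "coprime s 8" for s
  proof -
    interpret galois_gen q n F s by unfold_locales (simp add: that)
    show "let C = (lspan {frob q 0, frob q s, frob q (3 * s)} :: ('a \<Rightarrow> 'a) set)
      in gab_index q n C = 2 \<and> h_val q n C = 1"
      "let C = (lspan {frob q 0, frob q (2 * s), frob q (3 * s), frob q (4 * s), frob q (5 * s)} :: ('a \<Rightarrow> 'a) set)
      in gab_index q n C = 4 \<and> h_val q n C = 3"
      using monomials_8[OF that(1)] by (simp_all add: T_def mult.commute Let_def)
  qed
  show ?thesis
    by (intro conjI allI impI; elim conjE;
        rule a[THEN conjunct1] a[THEN conjunct2] b c d f h i k ej gl; assumption)
qed

end
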